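(* (Lower bound for stochastic first-order methods in the finite-sum setting.) For any $L>0$, $\Delta>0$, and $2\le n\le\mathcal{O}\left(\Delta^2L^2\cdot\epsilon^{-4}\right)$, for any algorithm $\mathcal{A}$ of the form described in the context, there exist a dimension $d=\tilde{\mathcal{O}}\left(\Delta^2L^2\cdot n^2\epsilon^{-4}\right)$ and a function $f$ satisfying the assumptions (i) and (ii) of the context in the finite-sum case, such that in order to find a point $\tilde{\mathbf{x}}$ for which $\|\nabla f(\tilde{\mathbf{x}})\|\le\epsilon$, $\mathcal{A}$ must cost at least $\Omega\left(L\Delta\cdot n^{1/2}\epsilon^{-2}\right)$ stochastic gradient accesses.
   Context: Finite-sum case: $f(\mathbf{x})=\frac1n\sum_{i=1}^nf_i(\mathbf{x})$ on $\mathbb{R}^d$, where $n$ is the number of individual functions; $\epsilon>0$ is the precision accuracy and $\|\cdot\|$ is the Euclidean norm. A stochastic gradient access is an evaluation of the gradient $\nabla f_i$ of an individual function at a point. Algorithm class: a random algorithm $\mathcal{A}$ maps functions $f:\mathbb{R}^d\to\mathbb{R}$ to a sequence of iterates in $\mathbb{R}^{d+1}$, with $$[\mathbf{x}^k;i_k]=\mathcal{A}^{k}\big(\boldsymbol{\xi},\nabla f_{i_0}(\mathbf{x}^0),\nabla f_{i_1}(\mathbf{x}^1),\ldots,\nabla f_{i_{k-1}}(\mathbf{x}^{k-1})\big),\quad k\ge1,$$ where the $\mathcal{A}^k$ are measurable mappings into $\mathbb{R}^{d+1}$, $i_k$ is the individual function chosen by $\mathcal{A}$ at iteration $k$, and $\boldsymbol{\xi}$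 is a uniform random vector from $[0,1]$; moreover $[\mathbf{x}^0;i_0]=\mathcal{A}^0(\boldsymbol{\xi})$, where $\mathcal{A}^0$ is a measurable mapping. Assumptions on $f$ (finite-sum case): (i) $\Delta:=f(\mathbf{x}^0)-f^*<\infty$, where $f^*=\inf_{\mathbf{x}\in\mathbb{R}^d}f(\mathbf{x})$ is the global infimum value of $f$; (ii) averaged $L$-Lipschitz gradient: $\mathbb{E}_i\|\nabla f_i(\mathbf{x})-\nabla f_i(\mathbf{y})\|^2\le L^2\|\mathbf{x}-\mathbf{y}\|^2$ for all $\mathbf{x},\mathbf{y}$, with $i$ uniform in $\{1,\dots,n\}$. Notation: $p=\mathcal{O}(q)$ means $|p|\le Cq$, and $p=\Omega(q)$ means $|p|\ge Cq$, for a global constant $C$; $p=\tilde{\mathcal{O}}(q)$ means the same as $\mathcal{O}$ with $C$ hiding a poly-logarithmic factor of the parameters. *)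

theory Defs
  imports "HOL-Probability.Probability"
begin

text \<open>
  The dimension is existentially quantified inside the theorem, so it cannot be a type.  A point of
  \<open>\<real>\<^sup>d\<close> is a function \<open>nat \<Rightarrow> real\<close> that is \<open>undefined\<close> outside \<open>{..<d}\<close>; the Euclidean norm
  is \<^const>\<open>L2_set\<close> over \<open>{..<d}\<close>.
\<close>

type_synonym point = "nat \<Rightarrow> real"

definition Rd :: "nat \<Rightarrow> point measure" where
  "Rd d = (\<Pi>\<^sub>M j\<in>{..<d}. borel)"

definition enorm :: "nat \<Rightarrow> point \<Rightarrow> real" where
  "enorm d x = L2_set x {..<d}"

definition edist :: "nat \<Rightarrow> point \<Rightarrow> point \<Rightarrow> real" where
  "edist d x y = enorm d (\<lambda>j. x j - y j)"

text \<open>Frechet differentiability of \<open>\<phi> : \<real>\<^sup>d \<rightarrow> \<real>\<close> at \<open>x\<close>, in the form of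
  \<open>has_derivative_within_alt\<close>, with derivative \<open>h \<mapsto> \<langle>g, h\<rangle>\<close>.\<close>

definition has_gradient :: "nat \<Rightarrow> (point \<Rightarrow> real) \<Rightarrow> point \<Rightarrow> point \<Rightarrow> bool" where
  "has_gradient d \<phi> g x \<longleftrightarrow> g \<in> space (Rd d) \<and>
     (\<forall>e>0. \<exists>r>0. \<forall>y\<in>space (Rd d). edist d y x < r \<longrightarrow>
        \<bar>\<phi> y - \<phi> x - (\<Sum>j<d. g j * (y j - x j))\<bar> \<le> e * edist d y x)"

definition grad :: "nat \<Rightarrow> (point \<Rightarrow> real) \<Rightarrow> point \<Rightarrow> point" where
  "grad d \<phi> x = (THE g. has_gradient d \<phi> g x)"

definition finite_sum :: "nat \<Rightarrow> (nat \<Rightarrow> point \<Rightarrow> real) \<Rightarrow> point \<Rightarrow> real" where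
  "finite_sum n F x = (\<Sum>i=1..n. F i x) / real n"

text \<open>
  \<open>initial_gap d \<phi> x0 \<Delta>\<close> says \<open>\<phi>(x0) - inf \<phi> = \<Delta>\<close>; boundedness from below makes the infimum
  genuine (\<open>\<Delta> < \<infinity>\<close>).  The point \<open>x0\<close> is deterministic, since \<open>\<Delta>\<close> is a number.
\<close>

definition initial_gap :: "nat \<Rightarrow> (point \<Rightarrow> real) \<Rightarrow> point \<Rightarrow> real \<Rightarrow> bool" where
  "initial_gap d \<phi> x0 \<Delta> \<longleftrightarrow> bdd_below (\<phi> ` space (Rd d)) \<and>
     \<phi> x0 - (INF x\<in>space (Rd d). \<phi> x) = \<Delta>"

definition averaged_lipschitz_gradient ::
    "nat \<Rightarrow> nat \<Rightarrow> (nat \<Rightarrow> point \<Rightarrow> real) \<Rightarrow> real \<Rightarrow> bool" where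
  "averaged_lipschitz_gradient n d F L \<longleftrightarrow>
     (\<forall>i\<in>{1..n}. \<forall>x\<in>space (Rd d). \<exists>g. has_gradient d (F i) g x) \<and>
     (\<forall>x\<in>space (Rd d). \<forall>y\<in>space (Rd d).
        (\<Sum>i=1..n. (edist d (grad d (F i) x) (grad d (F i) y))\<^sup>2) / real n \<le> L\<^sup>2 * (edist d x y)\<^sup>2)"

abbreviation seed :: "real measure" where
  "seed \<equiv> uniform_measure lborel {0..1}"

text \<open>
  The \<open>k\<close>-th map of an algorithm takes the seed and the \<open>k\<close> gradients observed so far (a function
  on \<open>{..<k}\<close>) to the next query \<open>(x\<^sup>k, i\<^sub>k)\<close>.  The last real coordinate of a map into
  \<open>\<real>\<^sup>d\<^sup>+\<^sup>1\<close> only takes values in \<open>{1..n}\<close>, so it is given the discrete space on that set.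
\<close>

type_synonym algorithm = "nat \<Rightarrow> real \<times> (nat \<Rightarrow> point) \<Rightarrow> point \<times> nat"

definition stochastic_first_order :: "nat \<Rightarrow> nat \<Rightarrow> algorithm \<Rightarrow> bool" where
  "stochastic_first_order n d A \<longleftrightarrow>
     (\<forall>k. A k \<in> (seed \<Otimes>\<^sub>M (\<Pi>\<^sub>M l\<in>{..<k}. Rd d)) \<rightarrow>\<^sub>M (Rd d \<Otimes>\<^sub>M count_space {1..n}))"

primrec observed ::
    "nat \<Rightarrow> algorithm \<Rightarrow> (nat \<Rightarrow> point \<Rightarrow> real) \<Rightarrow> real \<Rightarrow> nat \<Rightarrow> (nat \<Rightarrow> point)" where
  "observed d A F \<xi> 0 = (\<lambda>_. undefined)"
| "observed d A F \<xi> (Suc k) =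
     (observed d A F \<xi> k)
       (k := (case A k (\<xi>, observed d A F \<xi> k) of (x, i) \<Rightarrow> grad d (F i) x))"

text \<open>The point \<open>x\<^sup>k\<close>, computed after exactly \<open>k\<close> stochastic gradient accesses.\<close>

definition iterate ::
    "nat \<Rightarrow> algorithm \<Rightarrow> (nat \<Rightarrow> point \<Rightarrow> real) \<Rightarrow> real \<Rightarrow> nat \<Rightarrow> point" where
  "iterate d A F \<xi> k = fst (A k (\<xi>, observed d A F \<xi> k))"

text \<open>
  The event, over the seed, that \<open>A\<close> spends at least \<open>T\<close> accesses on finding an \<open>\<epsilon>\<close>-stationary
  point of the average of \<open>F 1, \<dots>, F n\<close> (in particular if it never finds one).
\<close>

definition costs_at_least ::
    "nat \<Rightarrow> nat \<Rightarrow> algorithm \<Rightarrow> (nat \<Rightarrow> point \<Rightarrow> real) \<Rightarrow> real \<Rightarrow> real \<Rightarrow> real set" where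
  "costs_at_least n d A F \<epsilon> T =
     {\<xi> \<in> space seed. \<forall>k. enorm d (grad d (finite_sum n F) (iterate d A F \<xi> k)) \<le> \<epsilon> \<longrightarrow> T \<le> real k}"

end

theory Submission
  imports Defs
begin

text \<open>
  Split the coordinates into \<open>n K\<close> blocks \<open>(i, k)\<close> and hide in each block a centre of squared norm
  \<open>2\<close>.  Let \<open>D\<^sub>k\<close> be the squared distance from the \<open>k\<close>-th block of a point to its centre, and let \<open>F i\<close>
  be, up to affine scaling, the chain
  \<open>|u|\<^sup>2 / 128 - (\<Sum>k<K. e\<^sub>k (3 - D\<^sub>k)\<^sub>+\<^sup>2)\<close> with \<open>e\<^sub>0 = 1/16\<close> and \<open>e\<^sub>k = (1/2 - D\<^sub>k\<^sub>-\<^sub>1)\<^sub>+\<^sup>2\<close>.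
  The reward for approaching the centre of a block is switched on only once the preceding block is
  within squared distance \<open>1/2\<close> of its own centre.  Three features make this hard.

  \<^item> As long as some block of a chain has \<open>D > 1/4\<close>, the gradient of that chain is bounded away from
    zero (lemma \<open>large_gradient\<close>): at the first such block the pull towards the centre and the pull
    of the regulariser towards \<open>0\<close> do not cancel.

  \<^item> Each link acts only in balls around centres, so that queries of large norm learn nothing more
    than bounded ones, and the gradient of a chain is Lipschitz with a constant independent of \<open>K\<close>
    (\<open>chain_grad_lipschitz\<close>).  As the chains live on disjoint blocks, each may be scaled to have
    Lipschitz constant \<open>sqrt n * L\<close> and the averaged constant is still \<open>L\<close>.

  \<^item> Beyond the first block, a centre influences the gradient only if its own block or the preceding
    one has \<open>D < 1/2\<close>.  So one access to \<open>F i\<close> reveals at most one new centre of chain \<open>i\<close>, unless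
    the query lies, by luck, within squared distance \<open>1/2\<close> of a centre that is still hidden
    (\<open>reply_unlucky\<close>).

  The candidate centres have pairwise squared distance at least \<open>2\<close>, so a query is within squared
  distance \<open>1/2\<close> of at most one candidate per block.  Over a uniformly random choice of centres, luck
  thus has probability at most \<open>1 / |W|\<close> per query and block, where \<open>W\<close> is the set of candidates; a
  union bound over \<open>n K\<close> queries and \<open>n K\<close> blocks bounds it by \<open>\<delta>\<close> when \<open>|W| \<ge> (n K)\<^sup>2 / \<delta>\<close>.  Words
  with two ones, one in each half of a block of \<open>2 m\<close> coordinates, give \<open>m\<^sup>2\<close> candidates, and so a
  total dimension of order \<open>(n K)\<^sup>2 / sqrt \<delta>\<close>.  For each fixed seed the algorithm is deterministic, so
  the probability is a count of assignments (\<open>card_lucky_le\<close>); averaging over the assignments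
  (\<open>exists_good_instance\<close>) gives one instance that is good for all seeds outside a set of measure \<open>\<delta>\<close>.

  Without luck, fewer than \<open>n K / 2\<close> accesses leave more than half of the chains unfinished, and the
  average of the \<open>F i\<close> has a gradient above \<open>\<epsilon>\<close>.  The optimality gap of the average is at most of
  order \<open>K\<close>, so scaling it to \<open>\<Delta>\<close> allows \<open>K\<close> of order \<open>L \<Delta> / (sqrt n \<epsilon>\<^sup>2)\<close>, and \<open>n K / 2\<close> is
  of the claimed order.
\<close>

section \<open>A guessing game\<close>

text \<open>
  The interaction of a deterministic strategy \<open>Q\<close> with an oracle whose answer may depend on how often
  the queried index has been queried before.  The second component counts these visits.  A visit
  count is what lets the oracle withhold the part of a chain that has not been earned yet.
\<close>

primrec transcript ::
    "(nat \<Rightarrow> (nat \<Rightarrow> 'g) \<Rightarrow> 'x \<times> nat) \<Rightarrow> (nat \<Rightarrow> nat \<Rightarrow> 'x \<Rightarrow> 'g) \<Rightarrow> nat \<Rightarrow>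
     (nat \<Rightarrow> 'g) \<times> (nat \<Rightarrow> nat)" where
  "transcript Q G 0 = (\<lambda>_. undefined, \<lambda>_. 0)"
| "transcript Q G (Suc t) =
     (let (h, v) = transcript Q G t; (x, i) = Q t h
      in (h(t := G (v i) i x), v(i := Suc (v i))))"

abbreviation history where "history Q G t \<equiv> fst (transcript Q G t)"
abbreviation visits where "visits Q G t \<equiv> snd (transcript Q G t)"
abbreviation query_point where "query_point Q G t \<equiv> fst (Q t (history Q G t))"
abbreviation query_index where "query_index Q G t \<equiv> snd (Q t (history Q G t))"

lemma history_Suc:
  "history Q G (Suc t) = (history Q G t)
     (t := G (visits Q G t (query_index Q G t)) (query_index Q G t) (query_point Q G t))"
  by (simp add: case_prod_beta Let_def)

lemma visits_Suc:
  "visits Q G (Suc t) = (visits Q G t)(query_index Q G t := Suc (visits Q G t (query_index Q G t)))"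
  by (simp add: case_prod_beta Let_def)

lemma visits_mono: "s \<le> t \<Longrightarrow> visits Q G s i \<le> visits Q G t i"
proof (induction t)
  case (Suc t)
  then show ?case by (cases "s = Suc t") (auto simp: visits_Suc simp del: transcript.simps intro: le_SucI)
qed simp

lemma sum_visits_le: "finite I \<Longrightarrow> (\<Sum>i\<in>I. visits Q G t i) \<le> t"
proof (induction t)
  case (Suc t)
  let ?q = "query_index Q G t"
  have "(\<Sum>i\<in>I. visits Q G (Suc t) i) = (\<Sum>i\<in>I. visits Q G t i + (if i = ?q then 1 else 0))"
    unfolding visits_Suc by (rule sum.cong) auto
  also have "\<dots> = (\<Sum>i\<in>I. visits Q G t i) + (if ?q \<in> I then 1 else 0)"
    using Suc.prems by (simp add: sum.distrib sum.delta)
  also have "\<dots> \<le> Suc t" using Suc.IH[OF Suc.prems] by auto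
  finally show ?case .
qed simp

lemma transcript_cong:
  assumes "\<And>s. s < t \<Longrightarrow>
    G (visits Q G s (query_index Q G s)) (query_index Q G s) (query_point Q G s) =
    G' (visits Q G s (query_index Q G s)) (query_index Q G s) (query_point Q G s)"
  shows "transcript Q G t = transcript Q G' t"
  using assms
proof (induction t)
  case (Suc t)
  then have IH: "transcript Q G t = transcript Q G' t" by simp
  show ?case
    by (rule prod_eqI) (use Suc.prems[of t] IH in \<open>simp_all add: history_Suc visits_Suc del: transcript.simps\<close>)
qed simp

text \<open>
  If the answers at visit \<open>c\<close> of index \<open>i\<close> depend only on the secrets \<open>\<sigma> (i, k)\<close> with \<open>k \<le> c\<close>, then a
  secret whose turn has not come can be changed without any effect on the transcript.  Hence
  the secrets off \<open>b\<close> determine the query point, and by uniqueness of the lucky word also \<open>\<sigma> b\<close>.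
\<close>

lemma card_lucky_at_le:
  fixes G :: "(nat \<times> nat \<Rightarrow> 'w) \<Rightarrow> nat \<Rightarrow> nat \<Rightarrow> 'x \<Rightarrow> 'g"
  assumes I: "finite I" and W: "finite W" and b: "b \<in> I"
  assumes local: "\<And>\<sigma> \<sigma>' c i x. (\<And>k. k \<le> c \<Longrightarrow> \<sigma> (i, k) = \<sigma>' (i, k)) \<Longrightarrow> G \<sigma> c i x = G \<sigma>' c i x"
  assumes unique: "\<And>w w' x. w \<in> W \<Longrightarrow> w' \<in> W \<Longrightarrow> lucky b w x \<Longrightarrow> lucky b w' x \<Longrightarrow> w = w'"
  shows "card {\<sigma> \<in> I \<rightarrow>\<^sub>E W. visits Q (G \<sigma>) t (fst b) \<le> snd b \<and> lucky b (\<sigma> b) (query_point Q (G \<sigma>) t)}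
    \<le> card W ^ (card I - 1)"
proof -
  let ?L = "{\<sigma> \<in> I \<rightarrow>\<^sub>E W. visits Q (G \<sigma>) t (fst b) \<le> snd b \<and> lucky b (\<sigma> b) (query_point Q (G \<sigma>) t)}"
  let ?r = "\<lambda>\<sigma>. restrict \<sigma> (I - {b})"
  have "inj_on ?r ?L"
  proof (rule inj_onI)
    fix \<sigma> \<sigma>' assume s: "\<sigma> \<in> ?L" and s': "\<sigma>' \<in> ?L" and eq: "?r \<sigma> = ?r \<sigma>'"
    have off: "\<sigma> a = \<sigma>' a" if "a \<noteq> b" for a
    proof (cases "a \<in> I")
      case True
      then show ?thesis using fun_cong[OF eq, of a] that by (simp add: restrict_def)
    next
      case False
      then show ?thesis using s s' by (auto dest!: PiE_arb[of _ I _ a])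
    qed
    have "transcript Q (G \<sigma>) t = transcript Q (G \<sigma>') t"
    proof (rule transcript_cong, rule local, rule off)
      fix u k
      let ?i = "query_index Q (G \<sigma>) u"
      assume "u < t" and k: "k \<le> visits Q (G \<sigma>) u ?i"
      have "visits Q (G \<sigma>) (Suc u) ?i \<le> visits Q (G \<sigma>) t ?i"
        using \<open>u < t\<close> by (intro visits_mono) simp
      then have "visits Q (G \<sigma>) u ?i < visits Q (G \<sigma>) t ?i"
        unfolding visits_Suc by simp
      then show "(?i, k) \<noteq> b" using s k by auto
    qed
    then have "\<sigma> b = \<sigma>' b"
      using unique[of "\<sigma> b" "\<sigma>' b" "query_point Q (G \<sigma>) t"] s s' b by (auto dest: PiE_mem)
    then show "\<sigma> = \<sigma>'" using off by (intro ext) metis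
  qed
  moreover have "?r ` ?L \<subseteq> (I - {b}) \<rightarrow>\<^sub>E W" by (intro image_subsetI restrict_PiE_iff[THEN iffD2] ballI) (auto dest: PiE_mem)
  ultimately have "card ?L \<le> card ((I - {b}) \<rightarrow>\<^sub>E W)"
    by (rule card_inj_on_le) (use I W in \<open>auto intro: finite_PiE\<close>)
  also have "\<dots> = card W ^ (card I - 1)"
    using I b by (simp add: card_PiE)
  finally show ?thesis .
qed

lemma card_lucky_le:
  fixes G :: "(nat \<times> nat \<Rightarrow> 'w) \<Rightarrow> nat \<Rightarrow> nat \<Rightarrow> 'x \<Rightarrow> 'g"
  assumes I: "finite I" and W: "finite W"
  assumes local: "\<And>\<sigma> \<sigma>' c i x. (\<And>k. k \<le> c \<Longrightarrow> \<sigma> (i, k) = \<sigma>' (i, k)) \<Longrightarrow> G \<sigma> c i x = G \<sigma>' c i x"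
  assumes unique: "\<And>b w w' x. b \<in> I \<Longrightarrow> w \<in> W \<Longrightarrow> w' \<in> W \<Longrightarrow> lucky b w x \<Longrightarrow> lucky b w' x \<Longrightarrow> w = w'"
  shows "card {\<sigma> \<in> I \<rightarrow>\<^sub>E W. \<exists>t<T. \<exists>b\<in>I. visits Q (G \<sigma>) t (fst b) \<le> snd b \<and>
      lucky b (\<sigma> b) (query_point Q (G \<sigma>) t)} \<le> T * card I * card W ^ (card I - 1)"
proof -
  let ?L = "\<lambda>t b. {\<sigma> \<in> I \<rightarrow>\<^sub>E W. visits Q (G \<sigma>) t (fst b) \<le> snd b \<and> lucky b (\<sigma> b) (query_point Q (G \<sigma>) t)}"
  have at: "card (\<Union>b\<in>I. ?L t b) \<le> card I * card W ^ (card I - 1)" for t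
  proof -
    have "card (?L t b) \<le> card W ^ (card I - 1)" if b: "b \<in> I" for b
      by (rule card_lucky_at_le[OF I W b]) (fact local, fact unique[OF b])
    then have "(\<Sum>b\<in>I. card (?L t b)) \<le> of_nat (card I) * card W ^ (card I - 1)"
      by (rule sum_bounded_above)
    with card_UN_le[OF I, of "?L t"] show ?thesis by simp
  qed
  have "(\<Sum>t\<in>{..<T}. card (\<Union>b\<in>I. ?L t b)) \<le> of_nat (card {..<T}) * (card I * card W ^ (card I - 1))"
    using at by (rule sum_bounded_above)
  with card_UN_le[of "{..<T}" "\<lambda>t. \<Union>b\<in>I. ?L t b"]
  have "card (\<Union>t\<in>{..<T}. \<Union>b\<in>I. ?L t b) \<le> T * card I * card W ^ (card I - 1)"
    by (simp add: mult.assoc)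
  moreover have "{\<sigma> \<in> I \<rightarrow>\<^sub>E W. \<exists>t<T. \<exists>b\<in>I. visits Q (G \<sigma>) t (fst b) \<le> snd b \<and>
      lucky b (\<sigma> b) (query_point Q (G \<sigma>) t)} = (\<Union>t\<in>{..<T}. \<Union>b\<in>I. ?L t b)"
    by blast
  ultimately show ?thesis by (simp only:)
qed

text \<open>
  The bridge between the counting, which concerns the withholding oracle \<open>G\<close>, and the true oracle
  \<open>G'\<close>: the two interactions coincide until the first lucky query.
\<close>

lemma transcript_eq_of_no_luck:
  assumes agree: "\<And>c i x. (\<And>k. (i, k) \<in> I \<Longrightarrow> c \<le> k \<Longrightarrow> \<not> lucky (i, k) (\<sigma> (i, k)) x) \<Longrightarrow> G c i x = G' c i x"
  assumes unlucky: "\<And>s b. s < t \<Longrightarrow> b \<in> I \<Longrightarrow> visits Q G s (fst b) \<le> snd b \<Longrightarrow>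
    \<not> lucky b (\<sigma> b) (query_point Q G s)"
  shows "transcript Q G t = transcript Q G' t"
  by (rule transcript_cong, rule agree) (use unlucky in auto)

text \<open>
  A finished index takes \<open>K\<close> visits, so fewer than \<open>card I * K / 2\<close> queries finish fewer than half of
  the indices.
\<close>

lemma card_unfinished:
  assumes "finite I" and "2 * t < card I * K"
  shows "card I < 2 * card {i \<in> I. visits Q G t i < K}"
proof -
  let ?U = "{i \<in> I. visits Q G t i < K}"
  have "(card I - card ?U) * K = (\<Sum>i\<in>I - ?U. K)"
    using assms(1) by (simp add: card_Diff_subset)
  also have "\<dots> \<le> (\<Sum>i\<in>I - ?U. visits Q G t i)" by (intro sum_mono) auto
  also have "\<dots> \<le> t" using assms(1) by (intro sum_visits_le) auto
  finally have "2 * ((card I - card ?U) * K) < card I * K" using assms(2) by linarith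
  then have "2 * (card I - card ?U) < card I"
    by (metis mult.assoc mult_less_cancel2)
  then show ?thesis by linarith
qed

lemma observed_eq_history:
  assumes "\<And>i x. grad d (F i) x = R i x"
  shows "observed d A F \<xi> t = history (\<lambda>t h. A t (\<xi>, h)) (\<lambda>_. R) t"
  by (induction t) (simp_all add: history_Suc case_prod_beta assms del: transcript.simps(2))

text \<open>
  The probabilistic method with the order of averaging exchanged: the sum over \<open>\<Sigma>\<close> of the bad
  probabilities is the expected number of bad instances.
\<close>

lemma exists_good_instance:
  assumes "prob_space M" and fin: "finite \<Sigma>" and "\<Sigma> \<noteq> {}"
    and meas: "\<And>\<sigma>. \<sigma> \<in> \<Sigma> \<Longrightarrow> Bad \<sigma> \<in> sets M"
    and few: "\<And>\<xi>. \<xi> \<in> space M \<Longrightarrow> real (card {\<sigma> \<in> \<Sigma>. \<xi> \<in> Bad \<sigma>}) \<le> \<delta> * real (card \<Sigma>)"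
  shows "\<exists>\<sigma>\<in>\<Sigma>. measure M (Bad \<sigma>) \<le> \<delta>"
proof (rule ccontr)
  interpret prob_space M by fact
  assume "\<not> ?thesis"
  then have "(\<Sum>\<sigma>\<in>\<Sigma>. \<delta>) < (\<Sum>\<sigma>\<in>\<Sigma>. prob (Bad \<sigma>))"
    using assms by (intro sum_strict_mono) auto
  also have "\<dots> = (\<integral>\<xi>. (\<Sum>\<sigma>\<in>\<Sigma>. indicator (Bad \<sigma>) \<xi>) \<partial>M)"
    using meas by (subst Bochner_Integration.integral_sum) (auto simp: emeasure_eq_measure intro!: integrable_real_indicator)
  also have "\<dots> \<le> (\<integral>\<xi>. \<delta> * real (card \<Sigma>) \<partial>M)"
  proof (rule integral_mono)
    show "integrable M (\<lambda>\<xi>. \<Sum>\<sigma>\<in>\<Sigma>. indicator (Bad \<sigma>) \<xi> :: real)"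
      using meas by (intro Bochner_Integration.integrable_sum integrable_real_indicator) (auto simp: emeasure_eq_measure)
    fix \<xi> assume "\<xi> \<in> space M"
    have "(\<Sum>\<sigma>\<in>\<Sigma>. indicator (Bad \<sigma>) \<xi> :: real) = real (card {\<sigma> \<in> \<Sigma>. \<xi> \<in> Bad \<sigma>})"
      using fin by (simp add: indicator_def sum.If_cases Int_def)
    then show "(\<Sum>\<sigma>\<in>\<Sigma>. indicator (Bad \<sigma>) \<xi> :: real) \<le> \<delta> * real (card \<Sigma>)"
      using few[OF \<open>\<xi> \<in> space M\<close>] by simp
  qed simp
  also have "\<dots> = (\<Sum>\<sigma>\<in>\<Sigma>. \<delta>)" by (simp add: prob_space)
  finally show False by simp
qed

section \<open>Gradients from quadratic remainder bounds\<close>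

text \<open>
  Linear approximation with a remainder that is quadratic near \<open>x\<close>.  It is stronger than
  differentiability, but closed under products and compositions by plain algebra, with the remainder
  constants never made explicit.
\<close>

definition tangent_approx :: "nat \<Rightarrow> (point \<Rightarrow> real) \<Rightarrow> point \<Rightarrow> point \<Rightarrow> bool" where
  "tangent_approx d \<phi> g x \<longleftrightarrow> (\<exists>C\<ge>0. \<forall>y. edist d y x \<le> 1 \<longrightarrow>
     \<bar>\<phi> y - \<phi> x - (\<Sum>j<d. g j * (y j - x j))\<bar> \<le> C * (edist d y x)\<^sup>2)"

lemma edist_nonneg [simp]: "0 \<le> edist d x y"
  by (simp add: edist_def enorm_def L2_set_nonneg)

lemma edist_sq: "(edist d x y)\<^sup>2 = (\<Sum>j<d. (x j - y j)\<^sup>2)"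
  by (simp add: edist_def enorm_def L2_set_def sum_nonneg)

lemma inner_le_edist:
  "\<bar>\<Sum>j<d. g j * (y j - x j)\<bar> \<le> enorm d g * edist d y x"
  unfolding edist_def enorm_def
  by (rule order_trans[OF _ L2_set_mult_ineq]) (simp flip: abs_mult add: sum_abs)

lemma tangent_approxI:
  assumes "\<And>y. edist d y x \<le> 1 \<Longrightarrow>
     \<bar>\<phi> y - \<phi> x - (\<Sum>j<d. g j * (y j - x j))\<bar> \<le> C * (edist d y x)\<^sup>2"
  shows "tangent_approx d \<phi> g x"
  unfolding tangent_approx_def
proof (intro exI[of _ "max 0 C"] conjI allI impI)
  fix y assume "edist d y x \<le> 1"
  from assms[OF this] show "\<bar>\<phi> y - \<phi> x - (\<Sum>j<d. g j * (y j - x j))\<bar> \<le> max 0 C * (edist d y x)\<^sup>2"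
    by (rule order_trans) (intro mult_right_mono, auto)
qed simp

lemma tangent_approx_lipschitz:
  assumes "tangent_approx d \<phi> g x"
  obtains B where "B \<ge> 0" "\<And>y. edist d y x \<le> 1 \<Longrightarrow> \<bar>\<phi> y - \<phi> x\<bar> \<le> B * edist d y x"
proof -
  obtain C where C: "C \<ge> 0" "\<And>y. edist d y x \<le> 1 \<Longrightarrow>
     \<bar>\<phi> y - \<phi> x - (\<Sum>j<d. g j * (y j - x j))\<bar> \<le> C * (edist d y x)\<^sup>2"
    using assms unfolding tangent_approx_def by blast
  show ?thesis
  proof (rule that[of "C + enorm d g"])
    show "C + enorm d g \<ge> 0" using C(1) by (simp add: enorm_def L2_set_nonneg)
    fix y assume y: "edist d y x \<le> 1"
    have "C * (edist d y x)\<^sup>2 \<le> C * edist d y x"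
      using y C(1) by (intro mult_left_mono) (auto simp: power2_eq_square mult_left_le)
    then show "\<bar>\<phi> y - \<phi> x\<bar> \<le> (C + enorm d g) * edist d y x"
      using C(2)[OF y] inner_le_edist[of g y x d] by (simp add: distrib_right)
  qed
qed

lemma tangent_approx_const: "tangent_approx d (\<lambda>_. a) (\<lambda>_. 0) x"
  by (rule tangent_approxI[where C=0]) simp

lemma tangent_approx_add:
  assumes "tangent_approx d \<phi> g x" "tangent_approx d \<psi> h x"
  shows "tangent_approx d (\<lambda>x. \<phi> x + \<psi> x) (\<lambda>j. g j + h j) x"
proof -
  obtain C where C: "\<And>y. edist d y x \<le> 1 \<Longrightarrow>
     \<bar>\<phi> y - \<phi> x - (\<Sum>j<d. g j * (y j - x j))\<bar> \<le> C * (edist d y x)\<^sup>2"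
    using assms(1) unfolding tangent_approx_def by blast
  obtain C' where C': "\<And>y. edist d y x \<le> 1 \<Longrightarrow>
     \<bar>\<psi> y - \<psi> x - (\<Sum>j<d. h j * (y j - x j))\<bar> \<le> C' * (edist d y x)\<^sup>2"
    using assms(2) unfolding tangent_approx_def by blast
  show ?thesis
  proof (rule tangent_approxI[where C="C+C'"])
    fix y assume y: "edist d y x \<le> 1"
    show "\<bar>\<phi> y + \<psi> y - (\<phi> x + \<psi> x) - (\<Sum>j<d. (g j + h j) * (y j - x j))\<bar> \<le> (C+C') * (edist d y x)\<^sup>2"
      using C[OF y] C'[OF y] by (simp add: distrib_right sum.distrib)
  qed
qed

lemma tangent_approx_mult:
  assumes "tangent_approx d \<phi> g x" "tangent_approx d \<psi> h x"
  shows "tangent_approx d (\<lambda>x. \<phi> x * \<psi> x) (\<lambda>j. \<phi> x * h j + \<psi> x * g j) x"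
proof -
  obtain C where C: "\<And>y. edist d y x \<le> 1 \<Longrightarrow>
     \<bar>\<phi> y - \<phi> x - (\<Sum>j<d. g j * (y j - x j))\<bar> \<le> C * (edist d y x)\<^sup>2"
    using assms(1) unfolding tangent_approx_def by blast
  obtain C' where C': "\<And>y. edist d y x \<le> 1 \<Longrightarrow>
     \<bar>\<psi> y - \<psi> x - (\<Sum>j<d. h j * (y j - x j))\<bar> \<le> C' * (edist d y x)\<^sup>2"
    using assms(2) unfolding tangent_approx_def by blast
  obtain B where B: "B \<ge> 0" "\<And>y. edist d y x \<le> 1 \<Longrightarrow> \<bar>\<phi> y - \<phi> x\<bar> \<le> B * edist d y x"
    using tangent_approx_lipschitz[OF assms(1)] by blast
  obtain B' where B': "B' \<ge> 0" "\<And>y. edist d y x \<le> 1 \<Longrightarrow> \<bar>\<psi> y - \<psi> x\<bar> \<le> B' * edist d y x"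
    using tangent_approx_lipschitz[OF assms(2)] by blast
  show ?thesis
  proof (rule tangent_approxI[where C="\<bar>\<phi> x\<bar> * C' + \<bar>\<psi> x\<bar> * C + B * B'"])
    fix y assume y: "edist d y x \<le> 1"
    let ?g = "\<Sum>j<d. g j * (y j - x j)" and ?h = "\<Sum>j<d. h j * (y j - x j)"
    have "(\<Sum>j<d. (\<phi> x * h j + \<psi> x * g j) * (y j - x j)) = \<phi> x * ?h + \<psi> x * ?g"
      by (simp add: sum_distrib_left sum.distrib distrib_right mult.assoc)
    then have eq: "\<phi> y * \<psi> y - \<phi> x * \<psi> x - (\<Sum>j<d. (\<phi> x * h j + \<psi> x * g j) * (y j - x j))
      = \<phi> x * (\<psi> y - \<psi> x - ?h) + \<psi> x * (\<phi> y - \<phi> x - ?g) + (\<phi> y - \<phi> x) * (\<psi> y - \<psi> x)"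
      by (simp add: algebra_simps)
    have "\<bar>\<phi> x * (\<psi> y - \<psi> x - ?h) + \<psi> x * (\<phi> y - \<phi> x - ?g) + (\<phi> y - \<phi> x) * (\<psi> y - \<psi> x)\<bar>
      \<le> \<bar>\<phi> x\<bar> * \<bar>\<psi> y - \<psi> x - ?h\<bar> + \<bar>\<psi> x\<bar> * \<bar>\<phi> y - \<phi> x - ?g\<bar> + \<bar>\<phi> y - \<phi> x\<bar> * \<bar>\<psi> y - \<psi> x\<bar>"
      unfolding abs_mult[symmetric] by linarith
    also have "\<dots> \<le> \<bar>\<phi> x\<bar> * (C' * (edist d y x)\<^sup>2) + \<bar>\<psi> x\<bar> * (C * (edist d y x)\<^sup>2) +
        (B * edist d y x) * (B' * edist d y x)"
      by (intro add_mono mult_left_mono mult_mono C'[OF y] C[OF y] B(2)[OF y] B'(2)[OF y]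
          mult_nonneg_nonneg[OF B(1)] abs_ge_zero edist_nonneg)
    also have "\<dots> = (\<bar>\<phi> x\<bar> * C' + \<bar>\<psi> x\<bar> * C + B * B') * (edist d y x)\<^sup>2"
      by (simp add: algebra_simps power2_eq_square)
    finally show "\<bar>\<phi> y * \<psi> y - \<phi> x * \<psi> x - (\<Sum>j<d. (\<phi> x * h j + \<psi> x * g j) * (y j - x j))\<bar>
      \<le> (\<bar>\<phi> x\<bar> * C' + \<bar>\<psi> x\<bar> * C + B * B') * (edist d y x)\<^sup>2" unfolding eq .
  qed
qed

lemma tangent_approx_cmult:
  assumes "tangent_approx d \<phi> g x"
  shows "tangent_approx d (\<lambda>x. a * \<phi> x) (\<lambda>j. a * g j) x"
  using tangent_approx_mult[OF tangent_approx_const assms, of a] by simp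

lemma tangent_approx_sum:
  assumes "finite I" "\<And>i. i \<in> I \<Longrightarrow> tangent_approx d (\<phi> i) (g i) x"
  shows "tangent_approx d (\<lambda>x. \<Sum>i\<in>I. \<phi> i x) (\<lambda>j. \<Sum>i\<in>I. g i j) x"
  using assms
proof (induction I rule: finite_induct)
  case empty
  then show ?case using tangent_approx_const[of d 0] by simp
next
  case (insert a I)
  have "tangent_approx d (\<lambda>x. \<phi> a x + (\<Sum>i\<in>I. \<phi> i x)) (\<lambda>j. g a j + (\<Sum>i\<in>I. g i j)) x"
    by (rule tangent_approx_add) (use insert in auto)
  then show ?case using insert.hyps by simp
qed

lemma tangent_approx_compose:
  fixes f :: "real \<Rightarrow> real"
  assumes "tangent_approx d \<phi> g x" and f: "\<And>t. \<bar>f t - f (\<phi> x) - f' * (t - \<phi> x)\<bar> \<le> C0 * (t - \<phi> x)\<^sup>2" and C0: "C0 \<ge> 0"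
  shows "tangent_approx d (\<lambda>x. f (\<phi> x)) (\<lambda>j. f' * g j) x"
proof -
  obtain C where C: "\<And>y. edist d y x \<le> 1 \<Longrightarrow>
     \<bar>\<phi> y - \<phi> x - (\<Sum>j<d. g j * (y j - x j))\<bar> \<le> C * (edist d y x)\<^sup>2"
    using assms(1) unfolding tangent_approx_def by blast
  obtain B where B: "B \<ge> 0" "\<And>y. edist d y x \<le> 1 \<Longrightarrow> \<bar>\<phi> y - \<phi> x\<bar> \<le> B * edist d y x"
    using tangent_approx_lipschitz[OF assms(1)] by blast
  show ?thesis
  proof (rule tangent_approxI[where C="\<bar>f'\<bar> * C + C0 * B\<^sup>2"])
    fix y assume y: "edist d y x \<le> 1"
    let ?g = "\<Sum>j<d. g j * (y j - x j)"
    have "(\<Sum>j<d. f' * g j * (y j - x j)) = f' * ?g" by (simp add: sum_distrib_left mult.assoc)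
    then have eq: "f (\<phi> y) - f (\<phi> x) - (\<Sum>j<d. f' * g j * (y j - x j))
      = (f (\<phi> y) - f (\<phi> x) - f' * (\<phi> y - \<phi> x)) + f' * (\<phi> y - \<phi> x - ?g)" by (simp add: algebra_simps)
    have "\<bar>(f (\<phi> y) - f (\<phi> x) - f' * (\<phi> y - \<phi> x)) + f' * (\<phi> y - \<phi> x - ?g)\<bar>
      \<le> \<bar>f (\<phi> y) - f (\<phi> x) - f' * (\<phi> y - \<phi> x)\<bar> + \<bar>f'\<bar> * \<bar>\<phi> y - \<phi> x - ?g\<bar>"
      unfolding abs_mult[symmetric] by linarith
    also have "\<dots> \<le> C0 * (B * edist d y x)\<^sup>2 + \<bar>f'\<bar> * (C * (edist d y x)\<^sup>2)"
    proof (intro add_mono mult_left_mono C y)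
      have "(\<phi> y - \<phi> x)\<^sup>2 \<le> (B * edist d y x)\<^sup>2"
        using B(2)[OF y] using abs_le_square_iff[of "\<phi> y - \<phi> x" "B * edist d y x"] B(1) by simp
      then show "\<bar>f (\<phi> y) - f (\<phi> x) - f' * (\<phi> y - \<phi> x)\<bar> \<le> C0 * (B * edist d y x)\<^sup>2"
        using f[of "\<phi> y"] C0 by (meson mult_left_mono order_trans)
    qed simp
    also have "\<dots> = (\<bar>f'\<bar> * C + C0 * B\<^sup>2) * (edist d y x)\<^sup>2"
      by (simp add: algebra_simps power2_eq_square)
    finally show "\<bar>f (\<phi> y) - f (\<phi> x) - (\<Sum>j<d. f' * g j * (y j - x j))\<bar> \<le> (\<bar>f'\<bar> * C + C0 * B\<^sup>2) * (edist d y x)\<^sup>2"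
      unfolding eq .
  qed
qed

lemma tangent_approx_sum_squares:
  assumes S: "S \<subseteq> {..<d}"
  shows "tangent_approx d (\<lambda>x. \<Sum>j\<in>S. (x j - p j)\<^sup>2) (\<lambda>j. if j \<in> S then 2 * (x j - p j) else 0) x"
proof (rule tangent_approxI[where C=1])
  fix y
  have "(\<Sum>j<d. (if j \<in> S then 2 * (x j - p j) else 0) * (y j - x j)) = (\<Sum>j\<in>S. 2 * (x j - p j) * (y j - x j))"
    using S by (simp add: if_distrib[of "\<lambda>u. u * _"] sum.If_cases Int_absorb1 cong: if_cong)
  then have "(\<Sum>j\<in>S. (y j - p j)\<^sup>2) - (\<Sum>j\<in>S. (x j - p j)\<^sup>2)
      - (\<Sum>j<d. (if j \<in> S then 2 * (x j - p j) else 0) * (y j - x j)) = (\<Sum>j\<in>S. (y j - x j)\<^sup>2)"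
    by (simp add: power2_eq_square algebra_simps flip: sum_subtractf sum.distrib)
  moreover have "(\<Sum>j\<in>S. (y j - x j)\<^sup>2) \<le> (\<Sum>j<d. (y j - x j)\<^sup>2)"
    using S by (intro sum_mono2) auto
  ultimately show "\<bar>(\<Sum>j\<in>S. (y j - p j)\<^sup>2) - (\<Sum>j\<in>S. (x j - p j)\<^sup>2)
      - (\<Sum>j<d. (if j \<in> S then 2 * (x j - p j) else 0) * (y j - x j))\<bar> \<le> 1 * (edist d y x)\<^sup>2"
    by (simp add: edist_sq sum_nonneg)
qed

lemma edist_affine:
  assumes "\<beta> > 0"
  shows "edist d (\<lambda>j. (y j - x0 j) / \<beta>) (\<lambda>j. (x j - x0 j) / \<beta>) = edist d y x / \<beta>"
proof -
  have "edist d (\<lambda>j. (y j - x0 j) / \<beta>) (\<lambda>j. (x j - x0 j) / \<beta>) = L2_set (\<lambda>j. inverse \<beta> * (y j - x j)) {..<d}"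
    unfolding edist_def enorm_def by (rule L2_set_cong) (use assms in \<open>auto simp: field_simps\<close>)
  also have "\<dots> = inverse \<beta> * edist d y x"
    using assms by (simp add: edist_def enorm_def flip: L2_set_right_distrib)
  finally show ?thesis by (simp add: field_simps)
qed

lemma has_gradient_affine:
  assumes q: "tangent_approx d \<phi> g (\<lambda>j. (x j - x0 j) / \<beta>)" and \<beta>: "\<beta> > 0"
  shows "has_gradient d (\<lambda>x. a * \<phi> (\<lambda>j. (x j - x0 j) / \<beta>)) (\<lambda>j\<in>{..<d}. a / \<beta> * g j) x"
  unfolding has_gradient_def
proof (intro conjI allI impI)
  show "(\<lambda>j\<in>{..<d}. a / \<beta> * g j) \<in> space (Rd d)" by (simp add: Rd_def space_PiM)
  fix e :: real assume e: "e > 0"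
  let ?z = "\<lambda>y j. (y j - x0 j) / \<beta>"
  obtain C where C: "C \<ge> 0" "\<And>y. edist d y (?z x) \<le> 1 \<Longrightarrow>
     \<bar>\<phi> y - \<phi> (?z x) - (\<Sum>j<d. g j * (y j - ?z x j))\<bar> \<le> C * (edist d y (?z x))\<^sup>2"
    using q unfolding tangent_approx_def by blast
  define c where "c = \<bar>a\<bar> * C / \<beta>\<^sup>2 + 1"
  have c: "c > 0" using C(1) \<beta> by (simp add: c_def add_nonneg_pos)
  show "\<exists>r>0. \<forall>y\<in>space (Rd d). edist d y x < r \<longrightarrow>
      \<bar>a * \<phi> (?z y) - a * \<phi> (?z x) - (\<Sum>j<d. (\<lambda>j\<in>{..<d}. a / \<beta> * g j) j * (y j - x j))\<bar> \<le> e * edist d y x"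
  proof (intro exI[of _ "min \<beta> (e / c)"] conjI ballI impI)
    show "min \<beta> (e / c) > 0" using \<beta> e c by simp
    fix y assume y: "edist d y x < min \<beta> (e / c)"
    have "(\<Sum>j<d. (\<lambda>j\<in>{..<d}. a / \<beta> * g j) j * (y j - x j)) = (\<Sum>j<d. a * (g j * (?z y j - ?z x j)))"
      using \<beta> by (intro sum.cong) (auto simp: field_simps)
    then have "\<bar>a * \<phi> (?z y) - a * \<phi> (?z x) - (\<Sum>j<d. (\<lambda>j\<in>{..<d}. a / \<beta> * g j) j * (y j - x j))\<bar>
      = \<bar>a\<bar> * \<bar>\<phi> (?z y) - \<phi> (?z x) - (\<Sum>j<d. g j * (?z y j - ?z x j))\<bar>"
      by (simp add: sum_distrib_left algebra_simps flip: abs_mult)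
    also have "\<dots> \<le> \<bar>a\<bar> * (C * (edist d (?z y) (?z x))\<^sup>2)"
      using y \<beta> by (intro mult_left_mono C) (auto simp: edist_affine)
    also have "\<dots> = (\<bar>a\<bar> * C / \<beta>\<^sup>2) * edist d y x * edist d y x"
      using \<beta> by (simp add: edist_affine power2_eq_square)
    also have "\<dots> \<le> c * (e / c) * edist d y x"
      using y e c C(1) \<beta> by (intro mult_mono) (auto simp: c_def)
    finally show "\<bar>a * \<phi> (?z y) - a * \<phi> (?z x) - (\<Sum>j<d. (\<lambda>j\<in>{..<d}. a / \<beta> * g j) j * (y j - x j))\<bar> \<le> e * edist d y x"
      using c by simp
  qed
qed

lemma has_gradient_unique:
  assumes g: "has_gradient d \<phi> g x" and h: "has_gradient d \<phi> h x"
  shows "g = h"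
proof (rule PiE_ext[of _ "{..<d}" "\<lambda>_. UNIV"])
  show "g \<in> {..<d} \<rightarrow>\<^sub>E UNIV" "h \<in> {..<d} \<rightarrow>\<^sub>E UNIV"
    using g h by (auto simp: has_gradient_def Rd_def space_PiM)
  fix i assume i: "i \<in> {..<d}"
  show "g i = h i"
  proof (rule ccontr)
    assume ne: "g i \<noteq> h i"
    define e where "e = \<bar>g i - h i\<bar> / 3"
    have e: "e > 0" using ne by (simp add: e_def)
    obtain r where r: "r > 0" "\<And>y. y \<in> space (Rd d) \<Longrightarrow> edist d y x < r \<Longrightarrow>
        \<bar>\<phi> y - \<phi> x - (\<Sum>j<d. g j * (y j - x j))\<bar> \<le> e * edist d y x"
      using g e unfolding has_gradient_def by meson
    obtain s where s: "s > 0" "\<And>y. y \<in> space (Rd d) \<Longrightarrow> edist d y x < s \<Longrightarrow>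
        \<bar>\<phi> y - \<phi> x - (\<Sum>j<d. h j * (y j - x j))\<bar> \<le> e * edist d y x"
      using h e unfolding has_gradient_def by meson
    define t where "t = min r s / 2"
    have t: "t > 0" "t < r" "t < s" using r(1) s(1) by (auto simp: t_def)
    define y where "y = (\<lambda>j\<in>{..<d}. x j + (if j = i then t else 0))"
    have y: "y \<in> space (Rd d)" by (simp add: y_def Rd_def space_PiM)
    have lin: "(\<Sum>j<d. u j * (y j - x j)) = u i * t" for u
      proof -
      have "(\<Sum>j<d. u j * (y j - x j)) = (\<Sum>j<d. if j = i then u i * t else 0)"
        by (intro sum.cong) (auto simp: y_def)
      then show ?thesis using i by simp
    qed
    have "(edist d y x)\<^sup>2 = t\<^sup>2"
      proof -
      have "(\<Sum>j<d. (y j - x j)\<^sup>2) = (\<Sum>j<d. if j = i then t\<^sup>2 else 0)"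
        by (intro sum.cong) (auto simp: y_def)
      then show ?thesis using i by (simp add: edist_sq)
    qed
    then have dist: "edist d y x = t" using t by simp
    have "\<bar>\<phi> y - \<phi> x - g i * t\<bar> \<le> e * t" "\<bar>\<phi> y - \<phi> x - h i * t\<bar> \<le> e * t"
      using r(2)[OF y] s(2)[OF y] t by (simp_all add: dist lin)
    then have "\<bar>(g i - h i) * t\<bar> \<le> 2 * e * t" by (simp add: algebra_simps)
    then have "\<bar>g i - h i\<bar> * t \<le> (2 * e) * t" using t by (simp add: abs_mult)
    then have "\<bar>g i - h i\<bar> \<le> 2 * e" using t by simp
    then show False using e by (simp add: e_def)
  qed
qed

lemma grad_eqI: "has_gradient d \<phi> g x \<Longrightarrow> grad d \<phi> x = g"
  unfolding grad_def using has_gradient_unique by blast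

lemma tangent_approx_cong: "tangent_approx d \<phi> g x \<Longrightarrow> (\<And>j. j < d \<Longrightarrow> g j = h j) \<Longrightarrow> tangent_approx d \<phi> h x"
  unfolding tangent_approx_def by simp

section \<open>Truncated linear bumps\<close>

definition hat :: "real \<Rightarrow> real \<Rightarrow> real" where
  "hat c t = max 0 (c - t)"

lemma hat_nonneg: "0 \<le> hat c t"
  by (simp add: hat_def)

lemma hat_le: "0 \<le> c \<Longrightarrow> 0 \<le> t \<Longrightarrow> hat c t \<le> c"
  by (simp add: hat_def)

text \<open>
  The square of the hat is \<open>C\<^sup>1\<close> with derivative \<open>- 2 * hat c\<close>; its quadratic remainder has constant
  \<open>1\<close> even across the kink of the hat.
\<close>

lemma hat_sq_expansion: "\<bar>(hat c t)\<^sup>2 - (hat c s)\<^sup>2 - (- 2 * hat c s) * (t - s)\<bar> \<le> 1 * (t - s)\<^sup>2"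
proof (cases "s < c"; cases "t < c")
  assume *: "s < c" "\<not> t < c"
  have "0 \<le> (c - s) * (2 * (t - s) - (c - s))" using * by (intro mult_nonneg_nonneg) auto
  moreover have "0 \<le> ((t - s) - (c - s))\<^sup>2" by simp
  ultimately show ?thesis using * by (simp add: hat_def power2_eq_square algebra_simps abs_le_iff)
next
  assume *: "\<not> s < c" "t < c"
  have "(c - t)\<^sup>2 \<le> (s - t)\<^sup>2" using * by (intro power_mono) auto
  then show ?thesis using * by (simp add: hat_def power2_commute)
next
  assume "s < c" "t < c"
  then have "(hat c t)\<^sup>2 - (hat c s)\<^sup>2 - (- 2 * hat c s) * (t - s) = (t - s)\<^sup>2"
    by (simp add: hat_def power2_eq_square algebra_simps)
  then show ?thesis by simp
qed (simp add: hat_def)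

text \<open>
  As a function of the distance \<open>r\<close> the hat is Lipschitz, because it vanishes once \<open>r\<close> exceeds \<open>b\<close> and
  \<open>r\<^sup>2\<close> has slope at most \<open>2 b\<close> before that.
\<close>

lemma hat_lipschitz:
  assumes "0 \<le> r" "0 \<le> s" "0 \<le> b" "c \<le> b\<^sup>2"
  shows "\<bar>hat c (r\<^sup>2) - hat c (s\<^sup>2)\<bar> \<le> 2 * b * \<bar>r - s\<bar>"
proof -
  have main: "\<bar>hat c (r\<^sup>2) - hat c (s\<^sup>2)\<bar> \<le> 2 * b * \<bar>r - s\<bar>" if "0 \<le> r" "r \<le> s" for r s
  proof -
    have mono: "r\<^sup>2 \<le> s\<^sup>2" using that by (intro power_mono) auto
    then have dec: "hat c (s\<^sup>2) \<le> hat c (r\<^sup>2)" by (simp add: hat_def)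
    consider "b \<le> r" | "r < b" "s \<le> b" | "r < b" "b < s" by linarith
    then have "hat c (r\<^sup>2) - hat c (s\<^sup>2) \<le> 2 * b * (s - r)"
    proof cases
      case 1
      have "b\<^sup>2 \<le> r\<^sup>2" using 1 assms by (intro power_mono) auto
      then have "hat c (r\<^sup>2) = 0" using assms by (simp add: hat_def)
      moreover have "0 \<le> 2 * b * (s - r)" using that assms by simp
      ultimately show ?thesis using hat_nonneg[of c "s\<^sup>2"] by linarith
    next
      case 2
      have "hat c (r\<^sup>2) - hat c (s\<^sup>2) \<le> s\<^sup>2 - r\<^sup>2" using mono by (simp add: hat_def)
      also have "\<dots> = (s + r) * (s - r)" by (simp add: power2_eq_square algebra_simps)
      also have "\<dots> \<le> (2 * b) * (s - r)" using 2 that by (intro mult_right_mono) auto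
      finally show ?thesis .
    next
      case 3
      have "r\<^sup>2 \<le> b\<^sup>2" using 3 that by (intro power_mono) auto
      then have "hat c (r\<^sup>2) - hat c (s\<^sup>2) \<le> b\<^sup>2 - r\<^sup>2" using hat_nonneg[of c "s\<^sup>2"] assms by (simp add: hat_def)
      also have "\<dots> = (b + r) * (b - r)" by (simp add: power2_eq_square algebra_simps)
      also have "\<dots> \<le> (2 * b) * (s - r)" using 3 that by (intro mult_mono) auto
      finally show ?thesis .
    qed
    then show ?thesis using dec that by simp
  qed
  show ?thesis
    using main[of r s] main[of s r] assms by (cases "r \<le> s") (auto simp: abs_minus_commute)
qed

lemma hat_sq_lipschitz:
  assumes "0 \<le> r" "0 \<le> s" "0 \<le> b" "0 \<le> c" "c \<le> b\<^sup>2"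
  shows "\<bar>(hat c (r\<^sup>2))\<^sup>2 - (hat c (s\<^sup>2))\<^sup>2\<bar> \<le> 4 * b * c * \<bar>r - s\<bar>"
proof -
  have "\<bar>(hat c (r\<^sup>2))\<^sup>2 - (hat c (s\<^sup>2))\<^sup>2\<bar> = \<bar>hat c (r\<^sup>2) - hat c (s\<^sup>2)\<bar> * (hat c (r\<^sup>2) + hat c (s\<^sup>2))"
    using hat_nonneg[of c "r\<^sup>2"] hat_nonneg[of c "s\<^sup>2"]
    by (simp add: power2_eq_square square_diff_square_factored abs_mult mult.commute)
  also have "\<dots> \<le> (2 * b * \<bar>r - s\<bar>) * (c + c)"
    using assms by (intro mult_mono add_mono hat_le hat_lipschitz) (auto simp: hat_nonneg)
  finally show ?thesis by (simp add: algebra_simps)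
qed

lemma L2_set_scale: "L2_set (\<lambda>j. a * f j) S = \<bar>a\<bar> * L2_set f S"
  by (simp add: L2_set_def power_mult_distrib real_sqrt_mult flip: sum_distrib_left)

lemma L2_set_scaled_diff:
  "L2_set (\<lambda>j. a * v j - a' * v' j) S \<le> \<bar>a\<bar> * L2_set (\<lambda>j. v j - v' j) S + \<bar>a - a'\<bar> * L2_set v' S"
proof -
  have "L2_set (\<lambda>j. a * v j - a' * v' j) S = L2_set (\<lambda>j. a * (v j - v' j) + (a - a') * v' j) S"
    by (simp add: algebra_simps)
  also have "\<dots> \<le> L2_set (\<lambda>j. a * (v j - v' j)) S + L2_set (\<lambda>j. (a - a') * v' j) S"
    by (rule L2_set_triangle_ineq)
  finally show ?thesis by (simp add: L2_set_scale)
qed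

lemma L2_set_diff_commute: "L2_set (\<lambda>j. x j - y j) S = L2_set (\<lambda>j. y j - x j) S"
  by (simp add: L2_set_def power2_commute)

lemma L2_set_reverse_triangle:
  "\<bar>L2_set (\<lambda>j. x j - p j) S - L2_set (\<lambda>j. y j - p j) S\<bar> \<le> L2_set (\<lambda>j. x j - y j) S"
proof -
  have *: "L2_set (\<lambda>j. x j - p j) S \<le> L2_set (\<lambda>j. x j - y j) S + L2_set (\<lambda>j. y j - p j) S" for x y
    using L2_set_triangle_ineq[of "\<lambda>j. x j - y j" "\<lambda>j. y j - p j" S] by simp
  show ?thesis using *[of x y] *[of y x] L2_set_diff_commute[of x y S] by linarith
qed

lemma L2_set_sq: "(L2_set f S)\<^sup>2 = (\<Sum>j\<in>S. (f j)\<^sup>2)"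
  by (simp add: L2_set_def sum_nonneg)

text \<open>
  The gradient of a squared hat at \<open>|x - p|\<^sup>2\<close> is a multiple of the field \<open>hat c (|x - p|\<^sup>2) (x - p)\<close>.
  This lemma and the next bound the field and its variation; both hold on the whole space because the
  field vanishes outside the ball of radius \<open>b\<close> around \<open>p\<close>.
\<close>

lemma hat_field_bound:
  fixes S p
  defines "r \<equiv> \<lambda>x. L2_set (\<lambda>j. x j - p j) S"
  assumes b: "0 \<le> b" "0 \<le> c" "c \<le> b\<^sup>2"
  shows "L2_set (\<lambda>j. hat c ((r x)\<^sup>2) * (x j - p j)) S \<le> b ^ 3"
proof -
  have r0: "0 \<le> r x" by (simp add: r_def L2_set_nonneg)
  have "hat c ((r x)\<^sup>2) * r x \<le> b ^ 3"
  proof (cases "b \<le> r x")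
    case True
    then have "b\<^sup>2 \<le> (r x)\<^sup>2" using b(1) by (intro power_mono) auto
    then have "hat c ((r x)\<^sup>2) = 0" using b by (simp add: hat_def)
    then show ?thesis using b by simp
  next
    case False
    have "hat c ((r x)\<^sup>2) * r x \<le> b\<^sup>2 * b"
      using False b r0 hat_le[of c "(r x)\<^sup>2"] by (intro mult_mono) auto
    then show ?thesis by (simp add: power3_eq_cube power2_eq_square)
  qed
  then show ?thesis by (simp add: L2_set_scale r_def hat_nonneg)
qed

lemma hat_field_lipschitz:
  fixes S p
  defines "r \<equiv> \<lambda>x. L2_set (\<lambda>j. x j - p j) S"
  assumes b: "0 \<le> b" "0 \<le> c" "c \<le> b\<^sup>2"
  shows "L2_set (\<lambda>j. hat c ((r x)\<^sup>2) * (x j - p j) - hat c ((r y)\<^sup>2) * (y j - p j)) S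
    \<le> 3 * b\<^sup>2 * L2_set (\<lambda>j. x j - y j) S"
proof -
  have main: "L2_set (\<lambda>j. hat c ((r x)\<^sup>2) * (x j - p j) - hat c ((r y)\<^sup>2) * (y j - p j)) S
    \<comment> \<open>The difference is expanded so that the change of the hat multiplies the shorter vector \<open>y - p\<close>.\<close>
    \<le> 3 * b\<^sup>2 * L2_set (\<lambda>j. x j - y j) S" if le: "r y \<le> r x" for x y
  proof -
    have r0: "0 \<le> r x" "0 \<le> r y" by (simp_all add: r_def L2_set_nonneg)
    let ?\<delta> = "L2_set (\<lambda>j. x j - y j) S"
    have \<delta>: "\<bar>r x - r y\<bar> \<le> ?\<delta>" "0 \<le> ?\<delta>" unfolding r_def by (rule L2_set_reverse_triangle) (simp add: L2_set_nonneg)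
    have lip: "\<bar>hat c ((r x)\<^sup>2) - hat c ((r y)\<^sup>2)\<bar> \<le> 2 * b * ?\<delta>"
      using hat_lipschitz[OF r0 b(1,3)] mult_left_mono[OF \<delta>(1), of "2 * b"] b(1) by linarith
    have "\<bar>hat c ((r x)\<^sup>2) - hat c ((r y)\<^sup>2)\<bar> * r y \<le> (2 * b * ?\<delta>) * b"
    proof (cases "b \<le> r y")
      case True
      then have "b\<^sup>2 \<le> (r y)\<^sup>2" "b\<^sup>2 \<le> (r x)\<^sup>2" using b le by (auto intro!: power_mono)
      then have "hat c ((r x)\<^sup>2) = 0" "hat c ((r y)\<^sup>2) = 0" using b by (simp_all add: hat_def)
      then show ?thesis using b \<delta> by simp
    next
      case False
      then show ?thesis using lip r0 b \<delta> by (intro mult_mono) auto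
    qed
    moreover have "hat c ((r x)\<^sup>2) * ?\<delta> \<le> b\<^sup>2 * ?\<delta>"
      using hat_le[of c "(r x)\<^sup>2"] b \<delta> by (intro mult_right_mono) auto
    moreover have "L2_set (\<lambda>j. hat c ((r x)\<^sup>2) * (x j - p j) - hat c ((r y)\<^sup>2) * (y j - p j)) S
      \<le> hat c ((r x)\<^sup>2) * ?\<delta> + \<bar>hat c ((r x)\<^sup>2) - hat c ((r y)\<^sup>2)\<bar> * r y"
      using L2_set_scaled_diff[of "hat c ((r x)\<^sup>2)" "\<lambda>j. x j - p j" "hat c ((r y)\<^sup>2)" "\<lambda>j. y j - p j" S]
      by (simp add: r_def hat_nonneg)
    ultimately show ?thesis by (simp add: power2_eq_square algebra_simps)
  qed
  show ?thesis
  proof (cases "r y \<le> r x")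
    case False
    then show ?thesis using main[of x y]
      by (simp add: L2_set_diff_commute[of x y] L2_set_diff_commute[of "\<lambda>j. hat c ((r x)\<^sup>2) * (x j - p j)"])
  qed (rule main)
qed

lemma sum_sq_le: "(a + b + c)\<^sup>2 \<le> 3 * (a\<^sup>2 + b\<^sup>2 + (c::real)\<^sup>2)"
proof -
  have "0 \<le> (a - b)\<^sup>2 + (b - c)\<^sup>2 + (a - c)\<^sup>2" by simp
  then show ?thesis by (simp add: power2_eq_square algebra_simps)
qed

section \<open>Chains of hidden centres\<close>

text \<open>
  A coordinate \<open>j\<close> belongs to the block \<open>pos j = (i, k)\<close>, the \<open>k\<close>-th block of the \<open>i\<close>-th chain.
  All centres of all blocks are stored in a single point \<open>p\<close>.
\<close>

locale chains =
  fixes d n K :: nat and pos :: "nat \<Rightarrow> nat \<times> nat"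
  assumes pos_in: "\<And>j. j < d \<Longrightarrow> pos j \<in> {1..n} \<times> {..<K}"
    and n_pos: "0 < n" and K_pos: "0 < K"
begin

definition block :: "nat \<times> nat \<Rightarrow> nat set" where
  "block b = {j. j < d \<and> pos j = b}"

definition sqdist :: "point \<Rightarrow> nat \<times> nat \<Rightarrow> point \<Rightarrow> real" where
  "sqdist p b x = (\<Sum>j\<in>block b. (x j - p j)\<^sup>2)"

definition entry :: "point \<Rightarrow> nat \<Rightarrow> nat \<Rightarrow> point \<Rightarrow> real" where
  "entry p i k x = (if k = 0 then 1/16 else (hat (1/2) (sqdist p (i, k - 1) x))\<^sup>2)"

definition reward :: "point \<Rightarrow> nat \<Rightarrow> nat \<Rightarrow> point \<Rightarrow> real" where
  "reward p i k x = (hat 3 (sqdist p (i, k) x))\<^sup>2"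

definition chain :: "point \<Rightarrow> nat \<Rightarrow> point \<Rightarrow> real" where
  "chain p i x = (\<Sum>j\<in>{j. j < d \<and> fst (pos j) = i}. (x j)\<^sup>2) / 128 - (\<Sum>k<K. entry p i k x * reward p i k x)"

text \<open>
  The force on block \<open>k\<close> towards its centre, if only the links up to \<open>c\<close> are present.  The true
  gradient has \<open>c = K - 1\<close>; smaller \<open>c\<close> describe what a chain shows before its later centres have been
  earned.
\<close>

definition pull :: "point \<Rightarrow> nat \<Rightarrow> nat \<Rightarrow> nat \<Rightarrow> point \<Rightarrow> real" where
  "pull p c i k x =
     (if k \<le> c then 4 * entry p i k x * hat 3 (sqdist p (i, k) x) else 0) +
     (if k < c then 4 * hat (1/2) (sqdist p (i, k) x) * reward p i (Suc k) x else 0)"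

definition chain_grad :: "point \<Rightarrow> nat \<Rightarrow> nat \<Rightarrow> point \<Rightarrow> point" where
  "chain_grad p c i x j =
     (if fst (pos j) = i then pull p c i (snd (pos j)) x * (x j - p j) + x j / 64 else 0)"

lemma finite_block [simp]: "finite (block b)" and block_subset: "block b \<subseteq> {..<d}"
  by (auto simp: block_def)

lemma sum_blocks: "(\<Sum>j<d. f j) = (\<Sum>i=1..n. \<Sum>k<K. \<Sum>j\<in>block (i, k). f j)"
proof -
  have "pos ` {..<d} \<subseteq> {1..n} \<times> {..<K}" using pos_in by blast
  then have "(\<Sum>j<d. f j) = (\<Sum>b\<in>{1..n} \<times> {..<K}. \<Sum>j\<in>{j \<in> {..<d}. pos j = b}. f j)"
    by (intro sum.group[symmetric]) auto
  also have "\<dots> = (\<Sum>i=1..n. \<Sum>k<K. \<Sum>j\<in>block (i, k). f j)"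
    by (simp add: block_def sum.cartesian_product)
  finally show ?thesis .
qed

lemma sqdist_nonneg: "0 \<le> sqdist p b x"
  by (simp add: sqdist_def sum_nonneg)

lemma sqdist_eq: "sqdist p b x = (L2_set (\<lambda>j. x j - p j) (block b))\<^sup>2"
  by (simp add: sqdist_def L2_set_sq)

lemma entry_nonneg: "0 \<le> entry p i k x" and reward_nonneg: "0 \<le> reward p i k x"
  by (simp_all add: entry_def reward_def)

lemma entry_le: "entry p i k x \<le> 1/4"
  using power_mono[OF hat_le[of "1/2" "sqdist p (i, k - 1) x"], of 2]
  by (auto simp: entry_def sqdist_nonneg hat_nonneg power2_eq_square)

lemma reward_le: "reward p i k x \<le> 9"
  using power_mono[OF hat_le[of 3 "sqdist p (i, k) x"], of 2]
  by (auto simp: reward_def sqdist_nonneg hat_nonneg)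

lemma pull_nonneg: "0 \<le> pull p c i k x"
  by (simp add: pull_def entry_nonneg reward_nonneg hat_nonneg)

lemma tangent_approx_sqdist: "tangent_approx d (sqdist p b) (\<lambda>j. if j \<in> block b then 2 * (x j - p j) else 0) x"
  unfolding sqdist_def using tangent_approx_sum_squares[OF block_subset] .

lemma tangent_approx_hat_sqdist:
  "tangent_approx d (\<lambda>x. (hat c (sqdist p b x))\<^sup>2)
     (\<lambda>j. - 2 * hat c (sqdist p b x) * (if j \<in> block b then 2 * (x j - p j) else 0)) x"
  by (rule tangent_approx_compose[OF tangent_approx_sqdist, where f = "\<lambda>t. (hat c t)\<^sup>2" and ?C0.0 = 1])
    (use hat_sq_expansion in auto)

text \<open>
  Block \<open>k\<close> occurs in two links, in link \<open>k\<close> through its reward and in link \<open>k + 1\<close> through its entry;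
  these are the two summands of \<^const>\<open>pull\<close>.
\<close>

lemma tangent_approx_chain: "tangent_approx d (chain p i) (chain_grad p (K - 1) i x) x"
proof -
  define B where "B k = (\<lambda>j. if j \<in> block (i, k) then 2 * (x j - p j) else 0)" for k
  define rg where "rg k = (\<lambda>j. - 2 * hat 3 (sqdist p (i, k) x) * B k j)" for k
  define eg where "eg k = (\<lambda>j. if k = 0 then 0 else - 2 * hat (1/2) (sqdist p (i, k - 1) x) * B (k - 1) j)" for k
  have r: "tangent_approx d (reward p i k) (rg k) x" for k
    unfolding reward_def rg_def B_def by (rule tangent_approx_hat_sqdist)
  have e: "tangent_approx d (entry p i k) (eg k) x" for k
  proof (cases "k = 0")
    case True
    then have "entry p i k = (\<lambda>_. 1/16)" "eg k = (\<lambda>_. 0)" by (simp_all add: entry_def eg_def fun_eq_iff)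
    then show ?thesis by (simp add: tangent_approx_const)
  next
    case False
    then show ?thesis unfolding entry_def eg_def B_def by (simp only: if_False) (rule tangent_approx_hat_sqdist)
  qed
  have sub: "{j. j < d \<and> fst (pos j) = i} \<subseteq> {..<d}" by auto
  have "tangent_approx d (\<lambda>x. (1/128) * (\<Sum>j\<in>{j. j < d \<and> fst (pos j) = i}. (x j - 0)\<^sup>2) +
      (-1) * (\<Sum>k\<in>{..<K}. entry p i k x * reward p i k x))
    (\<lambda>j. (1/128) * (if j \<in> {j. j < d \<and> fst (pos j) = i} then 2 * (x j - 0) else 0) +
      (-1) * (\<Sum>k\<in>{..<K}. entry p i k x * rg k j + reward p i k x * eg k j)) x" (is "tangent_approx d ?f ?g x")
    by (intro tangent_approx_add tangent_approx_cmult tangent_approx_sum tangent_approx_mult r e finite_lessThan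
        tangent_approx_sum_squares[OF sub, where p = "\<lambda>_. 0"])
  moreover have "?f = chain p i"
    by (simp add: chain_def fun_eq_iff)
  moreover have "?g j = chain_grad p (K - 1) i x j" if j: "j < d" for j
  proof -
    obtain i' k0 where pos: "pos j = (i', k0)" by (cases "pos j")
    have k0: "k0 < K" using pos_in[OF j] pos by auto
    have mem: "j \<in> block (i, k) \<longleftrightarrow> i' = i \<and> k0 = k" for k using j pos by (auto simp: block_def)
    show ?thesis
    proof (cases "i' = i")
      case False
      then show ?thesis by (auto simp: chain_grad_def pos rg_def eg_def B_def mem intro!: sum.neutral)
    next
      case True
      have "(\<Sum>k<K. entry p i k x * rg k j) =
          (\<Sum>k<K. if k = k0 then - 4 * entry p i k0 x * hat 3 (sqdist p (i, k0) x) * (x j - p j) else 0)"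
        using True by (intro sum.cong) (auto simp: rg_def B_def mem)
      also have "\<dots> = - 4 * entry p i k0 x * hat 3 (sqdist p (i, k0) x) * (x j - p j)"
        using k0 by simp
      finally have 1: "(\<Sum>k<K. entry p i k x * rg k j) = \<dots>" .
      have "(\<Sum>k<K. reward p i k x * eg k j) =
          (\<Sum>k<K. if k = Suc k0 then - 4 * hat (1/2) (sqdist p (i, k0) x) * reward p i (Suc k0) x * (x j - p j) else 0)"
        using True by (intro sum.cong) (auto simp: eg_def B_def mem)
      also have "\<dots> = (if k0 < K - 1 then - 4 * hat (1/2) (sqdist p (i, k0) x) * reward p i (Suc k0) x * (x j - p j) else 0)"
        by auto
      finally have 2: "(\<Sum>k<K. reward p i k x * eg k j) = \<dots>" .
      have "k0 \<le> K - 1" using k0 by simp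
      then show ?thesis using j True
        unfolding sum.distrib 1 2 by (simp add: chain_grad_def pos pull_def algebra_simps)
    qed
  qed
  ultimately show ?thesis by (metis (no_types, lifting) tangent_approx_cong)
qed

lemma chain_grad_cong:
  assumes "\<And>j. j < d \<Longrightarrow> fst (pos j) = i \<Longrightarrow> snd (pos j) \<le> c \<Longrightarrow> p j = p' j" and "j < d"
  shows "chain_grad p c i x j = chain_grad p' c i x j"
proof -
  have sqdist: "sqdist p (i, k) x = sqdist p' (i, k) x" if "k \<le> c" for k
    unfolding sqdist_def using assms(1) that by (intro sum.cong) (auto simp: block_def)
  have pull: "pull p c i k x = pull p' c i k x" for k
    by (auto simp: pull_def entry_def reward_def sqdist)
  show ?thesis
  proof (cases "snd (pos j) \<le> c")
    case True
    then show ?thesis using assms by (auto simp: chain_grad_def pull)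
  next
    case False
    then have "pull p c i (snd (pos j)) x = 0" by (simp add: pull_def)
    then show ?thesis using pull by (auto simp: chain_grad_def)
  qed
qed

text \<open>
  If \<open>1/2 \<le> D\<close> on all blocks from \<open>c\<close> on, then the entries of all links beyond \<open>c\<close> vanish together with
  their derivatives, so removing these links does not change the gradient.
\<close>

lemma chain_grad_unlucky:
  assumes "\<And>k. c \<le> k \<Longrightarrow> k < K \<Longrightarrow> 1/2 \<le> sqdist p (i, k) x" and c: "c < K" and j: "j < d"
  shows "chain_grad p c i x j = chain_grad p (K - 1) i x j"
proof -
  have hat0: "hat (1/2) (sqdist p (i, k) x) = 0" if "c \<le> k" "k < K" for k
    using assms(1)[OF that] by (simp add: hat_def)
  define k where "k = snd (pos j)"
  have k: "k < K" using pos_in[OF j] by (auto simp: k_def mem_Times_iff)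
  have "pull p c i k x = pull p (K - 1) i k x"
  proof (cases "k \<le> c")
    case True
    consider "k < c" | "k = c" using True by linarith
    then show ?thesis using k c hat0[of k] by cases (auto simp: pull_def)
  next
    case False
    then have "entry p i k x = 0" using hat0[of "k - 1"] k by (simp add: entry_def)
    then show ?thesis using False k hat0[of k] by (auto simp: pull_def)
  qed
  then show ?thesis by (simp add: chain_grad_def k_def)
qed


text \<open>
  At the first block \<open>m\<close> with \<open>D > 1/4\<close> the entry is at least \<open>1/16\<close>.  The gradient in this block is
  \<open>\<mu> (u - p) + u / 64\<close> with \<open>\<mu> \<ge> 0\<close>, and it is tested against \<open>u - p\<close>.  For \<open>D < 5/2\<close> the reward makes
  \<open>\<mu>\<close> large enough; for larger \<open>D\<close>, where the reward may be out of reach, the regulariser alone points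
  outwards, as \<open>|p|\<^sup>2 = 2\<close>.
\<close>

lemma large_gradient:
  assumes i: "i \<in> {1..n}" and norm_p: "\<And>k. k < K \<Longrightarrow> (\<Sum>j\<in>block (i, k). (p j)\<^sup>2) = 2"
    and "k < K" and far: "1/4 < sqdist p (i, k) x"
  shows "1/163840 \<le> (\<Sum>j<d. (chain_grad p (K - 1) i x j)\<^sup>2)"
proof -
  define m where "m = (LEAST k. k < K \<and> 1/4 < sqdist p (i, k) x)"
  have m: "m < K" "1/4 < sqdist p (i, m) x"
    using LeastI[of "\<lambda>k. k < K \<and> 1/4 < sqdist p (i, k) x" k] assms by (auto simp: m_def)
  have before: "sqdist p (i, k) x \<le> 1/4" if "k < m" for k
  proof -
    have "\<not> (k < K \<and> 1/4 < sqdist p (i, k) x)"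
      using that unfolding m_def by (rule not_less_Least)
    then show ?thesis using that m(1) by auto
  qed
  define D where "D = sqdist p (i, m) x"
  define \<mu> where "\<mu> = pull p (K - 1) i m x"
  let ?S = "block (i, m)"
  have entry: "1/16 \<le> entry p i m x"
  proof (cases "m = 0")
    case False
    then have "1/4 \<le> hat (1/2) (sqdist p (i, m - 1) x)" using before[of "m - 1"] by (simp add: hat_def)
    then show ?thesis using False power_mono[of "1/4" "hat (1/2) (sqdist p (i, m - 1) x)" 2]
      by (simp add: entry_def power2_eq_square)
  qed (simp add: entry_def)
  have "4 * (1/16) * hat 3 D \<le> 4 * entry p i m x * hat 3 D"
    using entry by (intro mult_right_mono) (auto simp: hat_nonneg)
  also have "\<dots> \<le> \<mu>"
  proof -
    have "m \<le> K - 1" using m(1) by simp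
    then show ?thesis by (simp add: \<mu>_def pull_def D_def hat_nonneg reward_nonneg)
  qed
  finally have \<mu>: "hat 3 D / 4 \<le> \<mu>" by simp
  have \<mu>0: "0 \<le> \<mu>" by (simp add: \<mu>_def pull_nonneg)
  define V where "V = (\<Sum>j\<in>?S. (\<mu> * (x j - p j) + x j / 64)\<^sup>2)"
  define P where "P = (\<Sum>j\<in>?S. (\<mu> * (x j - p j) + x j / 64) * (x j - p j))"
  have P_eq: "P = \<mu> * D + (\<Sum>j\<in>?S. x j * (x j - p j)) / 64"
    unfolding P_def D_def sqdist_def sum_distrib_left sum_divide_distrib sum.distrib[symmetric]
    by (intro sum.cong) (auto simp: power2_eq_square algebra_simps)
  have "2 * (\<Sum>j\<in>?S. x j * (x j - p j)) = (\<Sum>j\<in>?S. (x j)\<^sup>2) + D - (\<Sum>j\<in>?S. (p j)\<^sup>2)"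
    unfolding D_def sqdist_def sum_distrib_left sum.distrib[symmetric] sum_subtractf[symmetric]
    by (intro sum.cong) (auto simp: power2_eq_square algebra_simps)
  with norm_p[OF m(1)]
  have "2 * (\<Sum>j\<in>?S. x j * (x j - p j)) = (\<Sum>j\<in>?S. (x j)\<^sup>2) + D - 2" by simp
  then have P: "\<mu> * D + (D - 2) / 128 \<le> P"
    using sum_nonneg[of ?S "\<lambda>j. (x j)\<^sup>2"] by (simp add: P_eq)
  have CS: "P\<^sup>2 \<le> V * D"
    unfolding P_def V_def D_def sqdist_def by (rule Cauchy_Schwarz_ineq_sum)
  have D: "1/4 < D" using m by (simp add: D_def)
  have "1/163840 \<le> V"
  proof (cases "5/2 \<le> D")
    case True
    have "0 \<le> \<mu> * D" using \<mu>0 D by simp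
    then have "(D - 2) / 128 \<le> P" using P by linarith
    then have "((D - 2) / 128)\<^sup>2 \<le> P\<^sup>2" using True by (intro power_mono) auto
    then have "((D - 2) / 128)\<^sup>2 \<le> V * D" using CS by linarith
    moreover have "D / 163840 \<le> ((D - 2) / 128)\<^sup>2"
    proof -
      have "0 \<le> (D - 5/2) * (D - 8/5)" using True by simp
      then show ?thesis by (simp add: power2_eq_square field_simps)
    qed
    ultimately have "(1/163840) * D \<le> V * D" by simp
    then show ?thesis using D by simp
  next
    case False
    have "1/8 \<le> \<mu>" using \<mu> False by (simp add: hat_def)
    then have "1/8 * (1/4) \<le> \<mu> * D" using D by (intro mult_mono) auto
    then have "1/64 \<le> P" using P D by (simp add: field_simps)
    then have "(1/64)\<^sup>2 \<le> P\<^sup>2" by (intro power_mono) auto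
    then have "(1/64)\<^sup>2 \<le> V * D" using CS by linarith
    moreover have "(1/163840) * D \<le> (1/64)\<^sup>2" using False by (simp add: power2_eq_square)
    ultimately have "(1/163840) * D \<le> V * D" by linarith
    then show ?thesis using D by simp
  qed
  also have "V = (\<Sum>j\<in>?S. (chain_grad p (K - 1) i x j)\<^sup>2)"
    unfolding V_def by (intro sum.cong) (auto simp: chain_grad_def block_def \<mu>_def)
  also have "\<dots> \<le> (\<Sum>j<d. (chain_grad p (K - 1) i x j)\<^sup>2)"
    using block_subset by (intro sum_mono2) auto
  finally show ?thesis .
qed

text \<open>
  The force on a block involves only the block itself and its two neighbours, and it is a sum of
  products of bounded Lipschitz functions.  The constant \<open>128\<close> is a round upper bound.
\<close>

lemma block_grad_lipschitz:
  fixes p x y i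
  defines "\<delta> \<equiv> \<lambda>k. L2_set (\<lambda>j. x j - y j) (block (i, k))"
  assumes "k < K"
  shows "L2_set (\<lambda>j. chain_grad p (K - 1) i x j - chain_grad p (K - 1) i y j) (block (i, k))
    \<le> 128 * ((if k = 0 then 0 else \<delta> (k - 1)) + \<delta> k + (if k < K - 1 then \<delta> (Suc k) else 0))"
proof -
  let ?S = "block (i, k)"
  define r where "r x k = L2_set (\<lambda>j. x j - p j) (block (i, k))" for x k
  have r0: "0 \<le> r x k" and sqdist: "sqdist p (i, k) x = (r x k)\<^sup>2" for x k
    by (simp_all add: r_def sqdist_eq L2_set_nonneg)
  have \<delta>0: "0 \<le> \<delta> k" for k by (simp add: \<delta>_def L2_set_nonneg)
  have rd: "\<bar>r x k - r y k\<bar> \<le> \<delta> k" for k unfolding r_def \<delta>_def by (rule L2_set_reverse_triangle)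
  define f where "f c x = (\<lambda>j. hat c (sqdist p (i, k) x) * (x j - p j))" for c x
  have f_bound: "L2_set (f c x) ?S \<le> b ^ 3" if "0 \<le> b" "0 \<le> c" "c \<le> b\<^sup>2" for b c x
    unfolding f_def sqdist_eq using hat_field_bound[OF that] .
  have f_lip: "L2_set (\<lambda>j. f c x j - f c y j) ?S \<le> 3 * b\<^sup>2 * \<delta> k" if "0 \<le> b" "0 \<le> c" "c \<le> b\<^sup>2" for b c
    unfolding f_def sqdist_eq \<delta>_def using hat_field_lipschitz[OF that] .
  define R where "R x = (if k < K - 1 then reward p i (Suc k) x else 0)" for x
  have grad: "chain_grad p (K - 1) i x j = 4 * (entry p i k x * f 3 x j) + 4 * (R x * f (1/2) x j) + (1/64) * x j"
    if "j \<in> ?S" for x j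
  proof -
    have "k \<le> K - 1" using assms(2) by simp
    then show ?thesis using that by (simp add: chain_grad_def block_def pull_def f_def R_def algebra_simps)
  qed
  let ?d\<^sub>1 = "\<lambda>j. entry p i k x * f 3 x j - entry p i k y * f 3 y j"
  let ?d\<^sub>2 = "\<lambda>j. R x * f (1/2) x j - R y * f (1/2) y j"
  have "L2_set (\<lambda>j. chain_grad p (K - 1) i x j - chain_grad p (K - 1) i y j) ?S
    = L2_set (\<lambda>j. (4 * ?d\<^sub>1 j + 4 * ?d\<^sub>2 j) + (1/64) * (x j - y j)) ?S"
    by (intro L2_set_cong) (auto simp: grad field_simps simp del: One_nat_def)
  also have "\<dots> \<le> L2_set (\<lambda>j. 4 * ?d\<^sub>1 j + 4 * ?d\<^sub>2 j) ?S + L2_set (\<lambda>j. (1/64) * (x j - y j)) ?S"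
    by (rule L2_set_triangle_ineq)
  also have "L2_set (\<lambda>j. 4 * ?d\<^sub>1 j + 4 * ?d\<^sub>2 j) ?S \<le> L2_set (\<lambda>j. 4 * ?d\<^sub>1 j) ?S + L2_set (\<lambda>j. 4 * ?d\<^sub>2 j) ?S"
    by (rule L2_set_triangle_ineq)
  finally have total: "L2_set (\<lambda>j. chain_grad p (K - 1) i x j - chain_grad p (K - 1) i y j) ?S
    \<le> 4 * L2_set ?d\<^sub>1 ?S + 4 * L2_set ?d\<^sub>2 ?S + \<delta> k / 64"
    unfolding L2_set_scale by (simp add: \<delta>_def)
  have "L2_set ?d\<^sub>1 ?S \<le> \<bar>entry p i k x\<bar> * L2_set (\<lambda>j. f 3 x j - f 3 y j) ?S + \<bar>entry p i k x - entry p i k y\<bar> * L2_set (f 3 y) ?S"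
    by (rule L2_set_scaled_diff)
  also have "\<dots> \<le> (1/4) * (3 * 2\<^sup>2 * \<delta> k) + (if k = 0 then 0 else 2 * \<delta> (k - 1)) * 2 ^ 3"
  proof (intro add_mono mult_mono f_lip f_bound)
    show "\<bar>entry p i k x - entry p i k y\<bar> \<le> (if k = 0 then 0 else 2 * \<delta> (k - 1))"
      using hat_sq_lipschitz[OF r0[of x "k - 1"] r0[of y "k - 1"], of 1 "1/2"] rd[of "k - 1"]
      by (auto simp: entry_def sqdist)
  qed (use entry_le entry_nonneg \<delta>0 in \<open>auto simp: L2_set_nonneg\<close>)
  finally have 1: "L2_set ?d\<^sub>1 ?S \<le> 3 * \<delta> k + 16 * (if k = 0 then 0 else \<delta> (k - 1))" by (simp split: if_splits)
  have "L2_set ?d\<^sub>2 ?S \<le> \<bar>R x\<bar> * L2_set (\<lambda>j. f (1/2) x j - f (1/2) y j) ?S + \<bar>R x - R y\<bar> * L2_set (f (1/2) y) ?S"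
    by (rule L2_set_scaled_diff)
  also have "\<dots> \<le> 9 * (3 * 1\<^sup>2 * \<delta> k) + (if k < K - 1 then 24 * \<delta> (Suc k) else 0) * 1 ^ 3"
  proof (intro add_mono mult_mono f_lip f_bound)
    show "\<bar>R x - R y\<bar> \<le> (if k < K - 1 then 24 * \<delta> (Suc k) else 0)"
      using hat_sq_lipschitz[OF r0[of x "Suc k"] r0[of y "Suc k"], of 2 3] rd[of "Suc k"]
      by (auto simp: R_def reward_def sqdist)
  qed (use reward_le reward_nonneg \<delta>0 in \<open>auto simp: L2_set_nonneg R_def\<close>)
  finally have 2: "L2_set ?d\<^sub>2 ?S \<le> 27 * \<delta> k + 24 * (if k < K - 1 then \<delta> (Suc k) else 0)" by (simp split: if_splits)
  have "0 \<le> (if k = 0 then 0 else \<delta> (k - 1))" "0 \<le> (if k < K - 1 then \<delta> (Suc k) else 0)" using \<delta>0 by auto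
  moreover have "l \<le> 128 * (a + e + c)"
    if "l \<le> 4 * u + 4 * v + e / 64" "u \<le> 3 * e + 16 * a" "v \<le> 27 * e + 24 * c" "0 \<le> a" "0 \<le> c" "0 \<le> e"
    for l u v a c e :: real
    using that by simp
  ultimately show ?thesis using total 1 2 \<delta>0[of k] by blast
qed

lemma chain_grad_lipschitz:
  "(\<Sum>i=1..n. \<Sum>j<d. (chain_grad p (K - 1) i x j - chain_grad p (K - 1) i y j)\<^sup>2) \<le> 384\<^sup>2 * (\<Sum>j<d. (x j - y j)\<^sup>2)"
proof -
  define g where "g = (\<lambda>i j. chain_grad p (K - 1) i x j - chain_grad p (K - 1) i y j)"
  define \<delta> where "\<delta> i k = L2_set (\<lambda>j. x j - y j) (block (i, k))" for i k
  have \<delta>0: "0 \<le> \<delta> i k" for i k by (simp add: \<delta>_def L2_set_nonneg)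
  have one: "(\<Sum>j<d. (g i j)\<^sup>2) \<le> 384\<^sup>2 * (\<Sum>k<K. (\<delta> i k)\<^sup>2)" if i: "i \<in> {1..n}" for i
  proof -
    define a where "a k = (if k = 0 then 0 else (\<delta> i (k - 1))\<^sup>2)" for k
    define c where "c k = (if k < K - 1 then (\<delta> i (Suc k))\<^sup>2 else 0)" for k
    have "(\<Sum>j<d. (g i j)\<^sup>2) = (\<Sum>i'=1..n. \<Sum>k<K. \<Sum>j\<in>block (i', k). (g i j)\<^sup>2)"
      by (rule sum_blocks)
    also have "\<dots> = (\<Sum>i'=1..n. if i' = i then \<Sum>k<K. \<Sum>j\<in>block (i, k). (g i j)\<^sup>2 else 0)"
      by (intro sum.cong) (auto simp: g_def chain_grad_def block_def intro!: sum.neutral)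
    also have "\<dots> = (\<Sum>k<K. \<Sum>j\<in>block (i, k). (g i j)\<^sup>2)" using i by simp
    also have "\<dots> \<le> (\<Sum>k<K. 128\<^sup>2 * (3 * (a k + (\<delta> i k)\<^sup>2 + c k)))"
    proof (rule sum_mono)
      fix k assume k: "k \<in> {..<K}"
      let ?a = "if k = 0 then 0 else \<delta> i (k - 1)" and ?c = "if k < K - 1 then \<delta> i (Suc k) else 0"
      have "(\<Sum>j\<in>block (i, k). (g i j)\<^sup>2) = (L2_set (g i) (block (i, k)))\<^sup>2" by (simp add: L2_set_sq)
      also have "\<dots> \<le> (128 * (?a + \<delta> i k + ?c))\<^sup>2"
        using block_grad_lipschitz[of k p i x y] k
        by (intro power_mono) (auto simp: g_def \<delta>_def L2_set_nonneg)
      also have "\<dots> \<le> 128\<^sup>2 * (3 * (?a\<^sup>2 + (\<delta> i k)\<^sup>2 + ?c\<^sup>2))"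
        unfolding power_mult_distrib by (intro mult_left_mono sum_sq_le) simp
      also have "?a\<^sup>2 = a k" by (simp add: a_def)
      also have "?c\<^sup>2 = c k" by (simp add: c_def)
      finally show "(\<Sum>j\<in>block (i, k). (g i j)\<^sup>2) \<le> 128\<^sup>2 * (3 * (a k + (\<delta> i k)\<^sup>2 + c k))" .
    qed
    also have "\<dots> = 128\<^sup>2 * 3 * ((\<Sum>k<K. a k) + (\<Sum>k<K. (\<delta> i k)\<^sup>2) + (\<Sum>k<K. c k))"
      by (simp only: sum_distrib_left[symmetric] sum.distrib mult.assoc)
    also have "(\<Sum>k<K. a k) \<le> (\<Sum>k<K. (\<delta> i k)\<^sup>2)"
    proof -
      obtain K' where K': "K = Suc K'" using K_pos by (cases K) auto
      have "(\<Sum>k<K. a k) = (\<Sum>k<K'. (\<delta> i k)\<^sup>2)"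
        unfolding K' sum.lessThan_Suc_shift by (simp add: a_def)
      then show ?thesis unfolding K' by simp
    qed
    also have "(\<Sum>k<K. c k) \<le> (\<Sum>k<K. (\<delta> i k)\<^sup>2)"
    proof -
      obtain K' where K': "K = Suc K'" using K_pos by (cases K) auto
      have "(\<Sum>k<K. c k) = (\<Sum>k<K'. (\<delta> i (Suc k))\<^sup>2)"
        by (simp add: c_def K')
      then show ?thesis unfolding K' sum.lessThan_Suc_shift by simp
    qed
    finally show ?thesis by simp
  qed
  have "(\<Sum>i=1..n. \<Sum>j<d. (g i j)\<^sup>2) \<le> (\<Sum>i=1..n. 384\<^sup>2 * (\<Sum>k<K. (\<delta> i k)\<^sup>2))"
    by (intro sum_mono one)
  also have "\<dots> = 384\<^sup>2 * (\<Sum>j<d. (x j - y j)\<^sup>2)"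
    by (simp add: sum_blocks \<delta>_def L2_set_sq flip: sum_distrib_left)
  finally show ?thesis by (simp add: g_def)
qed

section \<open>Optimality gap, scaling and the averaged function\<close>

lemma sum_chain: 
  assumes "i \<in> {1..n}"
  shows "(\<Sum>j\<in>{j. j < d \<and> fst (pos j) = i}. f j) = (\<Sum>k<K. \<Sum>j\<in>block (i, k). f j)"
proof -
  have "(\<Sum>j\<in>{j. j < d \<and> fst (pos j) = i}. f j) = (\<Sum>j<d. if fst (pos j) = i then f j else 0)"
    by (simp add: sum.If_cases Int_def)
  also have "\<dots> = (\<Sum>i'=1..n. \<Sum>k<K. \<Sum>j\<in>block (i', k). if fst (pos j) = i then f j else 0)"
    by (rule sum_blocks)
  also have "\<dots> = (\<Sum>i'=1..n. if i' = i then \<Sum>k<K. \<Sum>j\<in>block (i, k). f j else 0)"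
    by (intro sum.cong) (auto simp: block_def intro!: sum.neutral)
  also have "\<dots> = (\<Sum>k<K. \<Sum>j\<in>block (i, k). f j)" using assms by simp
  finally show ?thesis .
qed

lemma chain_eqI:
  assumes "i \<in> {1..n}"
    and "\<And>k. k < K \<Longrightarrow> sqdist p (i, k) x = sqdist q (i, k) y"
    and "\<And>k. k < K \<Longrightarrow> (\<Sum>j\<in>block (i, k). (x j)\<^sup>2) = (\<Sum>j\<in>block (i, k). (y j)\<^sup>2)"
  shows "chain p i x = chain q i y"
proof -
  have "(\<Sum>k<K. entry p i k x * reward p i k x) = (\<Sum>k<K. entry q i k y * reward q i k y)"
    using assms(2) by (intro sum.cong refl) (simp add: entry_def reward_def less_imp_diff_less)
  then show ?thesis using assms(1,3) by (simp add: chain_def sum_chain)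
qed

text \<open>
  The common norm of the centres makes the value at \<open>0\<close> and the infimum of the averaged chains
  independent of the choice of the centres.
\<close>

definition centered :: "point \<Rightarrow> bool" where
  "centered p \<longleftrightarrow> (\<forall>b\<in>{1..n} \<times> {..<K}. (\<Sum>j\<in>block b. (p j)\<^sup>2) = 2)"

lemma chain_lower_bound: "- (9/4 * real K) \<le> chain p i x"
proof -
  have "(\<Sum>k<K. entry p i k x * reward p i k x) \<le> (\<Sum>k<K. 1/4 * 9)"
    by (intro sum_mono mult_mono entry_le reward_le) (auto simp: reward_nonneg)
  moreover have "0 \<le> (\<Sum>j\<in>{j. j < d \<and> fst (pos j) = i}. (x j)\<^sup>2) / 128" by (simp add: sum_nonneg)
  ultimately show ?thesis by (simp add: chain_def)
qed

lemma chain_zero_le: "chain p i (\<lambda>_. 0) \<le> 0"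
  by (simp add: chain_def sum_nonneg entry_nonneg reward_nonneg)

lemma chain_zero_ge:
  assumes "centered p" "i \<in> {1..n}"
  shows "- (1/16) \<le> chain p i (\<lambda>_. 0)"
proof -
  have sqdist: "sqdist p (i, k) (\<lambda>_. 0) = 2" if "k < K" for k
    using assms that by (simp add: centered_def sqdist_def)
  have "(\<Sum>k<K. entry p i k (\<lambda>_. 0) * reward p i k (\<lambda>_. 0)) = (\<Sum>k<K. if k = 0 then 1/16 else 0)"
    by (intro sum.cong) (auto simp: entry_def reward_def sqdist hat_def)
  also have "\<dots> = 1/16" using K_pos by simp
  finally show ?thesis by (simp add: chain_def)
qed

lemma chain_centre_less:
  assumes "centered p" "i \<in> {1..n}"
  shows "chain p i p < - (1/16)"
proof -
  have "(\<Sum>k<K. 1/16 * 9) \<le> (\<Sum>k<K. entry p i k p * reward p i k p)"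
    by (intro sum_mono mult_mono) (auto simp: entry_def reward_def sqdist_def hat_def power2_eq_square)
  moreover have "(\<Sum>j\<in>{j. j < d \<and> fst (pos j) = i}. (p j)\<^sup>2) = (\<Sum>k<K. 2)"
    using assms by (simp add: sum_chain centered_def)
  ultimately have "chain p i p \<le> real K * (2/128 - 9/16)" by (simp add: chain_def field_simps)
  also have "\<dots> \<le> 1 * (2/128 - 9/16)" using K_pos by (intro mult_right_mono_neg) auto
  finally show ?thesis by simp
qed

definition average :: "point \<Rightarrow> point \<Rightarrow> real" where
  "average p x = (\<Sum>i=1..n. chain p i x) / n"

definition gap :: "point \<Rightarrow> real" where
  "gap p = average p (\<lambda>_. 0) - (INF x. average p x)"

lemma average_lower_bound: "- (9/4 * real K) \<le> average p x"
proof -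
  have "(\<Sum>i=1..n. - (9/4 * real K)) \<le> (\<Sum>i=1..n. chain p i x)" by (intro sum_mono chain_lower_bound)
  then show ?thesis using n_pos by (simp add: average_def field_simps)
qed

lemma bdd_below_average: "bdd_below (range (average p))"
  using average_lower_bound by (intro bdd_belowI2)

lemma gap_le: "gap p \<le> 9/4 * real K"
proof -
  have "- (9/4 * real K) \<le> (INF x. average p x)" by (intro cINF_greatest average_lower_bound) simp
  moreover have "average p (\<lambda>_. 0) \<le> 0"
    unfolding average_def by (intro divide_nonpos_nonneg sum_nonpos chain_zero_le) auto
  ultimately show ?thesis by (simp add: gap_def)
qed

lemma gap_pos:
  assumes "centered p"
  shows "0 < gap p"
proof -
  have "(\<Sum>i=1..n. chain p i p) < (\<Sum>i=1..n. chain p i (\<lambda>_. 0))"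
    using chain_centre_less[OF assms] chain_zero_ge[OF assms] n_pos
    by (intro sum_strict_mono) (auto intro: less_le_trans)
  then have "average p p < average p (\<lambda>_. 0)" using n_pos by (simp add: average_def divide_strict_right_mono)
  moreover have "(INF x. average p x) \<le> average p p" by (rule cINF_lower[OF bdd_below_average]) simp
  ultimately show ?thesis by (simp add: gap_def)
qed

text \<open>
  In each block, the reflection exchanging the two centres of equal norm is an isometry that fixes \<open>0\<close>.
\<close>

lemma exists_reflection:
  assumes p: "centered p" and q: "centered q"
  shows "\<exists>y. \<forall>b\<in>{1..n} \<times> {..<K}. sqdist p b x = sqdist q b y \<and> (\<Sum>j\<in>block b. (x j)\<^sup>2) = (\<Sum>j\<in>block b. (y j)\<^sup>2)"
proof -
  define v where "v j = p j - q j" for j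
  define s where "s b = (\<Sum>j\<in>block b. (v j)\<^sup>2)" for b
  define t where "t b = 2 * (\<Sum>j\<in>block b. x j * v j) / s b" for b
  define y where "y j = x j - t (pos j) * v j" for j
  have "sqdist p b x = sqdist q b y \<and> (\<Sum>j\<in>block b. (x j)\<^sup>2) = (\<Sum>j\<in>block b. (y j)\<^sup>2)"
    if b: "b \<in> {1..n} \<times> {..<K}" for b
  proof (cases "s b = 0")
    case True
    then have "v j = 0" if "j \<in> block b" for j using that unfolding s_def
      by (subst (asm) sum_nonneg_eq_0_iff) auto
    then show ?thesis by (auto simp: y_def sqdist_def v_def intro!: sum.cong)
  next
    case False
    let ?xv = "\<Sum>j\<in>block b. x j * v j" and ?vq = "\<Sum>j\<in>block b. v j * q j" and ?xq = "\<Sum>j\<in>block b. x j * q j"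
    have y: "y j = x j - t b * v j" if "j \<in> block b" for j using that by (auto simp: y_def block_def)
    have "(\<Sum>j\<in>block b. (p j)\<^sup>2) = s b + 2 * ?vq + (\<Sum>j\<in>block b. (q j)\<^sup>2)"
      unfolding s_def sum_distrib_left sum.distrib[symmetric]
      by (intro sum.cong) (auto simp: v_def power2_eq_square algebra_simps)
    moreover have pq: "(\<Sum>j\<in>block b. (p j)\<^sup>2) = 2" "(\<Sum>j\<in>block b. (q j)\<^sup>2) = 2"
      using p q b unfolding centered_def by blast+
    ultimately have vq: "2 * ?vq = - s b" by simp
    have tv: "t b * s b = 2 * ?xv" using False by (simp add: t_def)
    have "(\<Sum>j\<in>block b. (y j)\<^sup>2) = (\<Sum>j\<in>block b. (x j)\<^sup>2) + (t b * (t b * s b) - t b * (2 * ?xv))"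
      unfolding s_def sum_distrib_left sum.distrib[symmetric] sum_subtractf[symmetric]
      by (intro sum.cong) (auto simp: y power2_eq_square algebra_simps)
    then have 1: "(\<Sum>j\<in>block b. (y j)\<^sup>2) = (\<Sum>j\<in>block b. (x j)\<^sup>2)" unfolding tv by simp
    have "sqdist q b y = (\<Sum>j\<in>block b. (y j)\<^sup>2) - 2 * ?xq + t b * (2 * ?vq) + (\<Sum>j\<in>block b. (q j)\<^sup>2)"
      unfolding sqdist_def sum_distrib_left sum.distrib[symmetric] sum_subtractf[symmetric]
      by (intro sum.cong) (auto simp: y power2_eq_square algebra_simps)
    also have "\<dots> = (\<Sum>j\<in>block b. (x j)\<^sup>2) - 2 * ?xq - 2 * ?xv + (\<Sum>j\<in>block b. (p j)\<^sup>2)"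
      using tv by (simp add: 1 vq pq)
    also have "\<dots> = sqdist p b x"
      unfolding sqdist_def sum_distrib_left sum.distrib[symmetric] sum_subtractf[symmetric]
      by (intro sum.cong) (auto simp: v_def power2_eq_square algebra_simps)
    finally show ?thesis using 1 by simp
  qed
  then show ?thesis by blast
qed

text \<open>
  The scaling factors depend on the gap.  If the gap depended on the centres, the scaling would
  leak information about centres that are still hidden.
\<close>

lemma gap_unique:
  assumes "centered p" "centered q"
  shows "gap p = gap q"
proof -
  have avg: "average p x = average q y"
    if isom: "\<forall>b\<in>{1..n} \<times> {..<K}. sqdist p b x = sqdist q b y \<and> (\<Sum>j\<in>block b. (x j)\<^sup>2) = (\<Sum>j\<in>block b. (y j)\<^sup>2)"
    for p q x y
  proof -
    have "chain p i x = chain q i y" if "i \<in> {1..n}" for i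
      using that isom by (intro chain_eqI) auto
    then show ?thesis by (simp add: average_def)
  qed
  have sub: "range (average p) \<subseteq> range (average q)" if pq: "centered p" "centered q" for p q
  proof (rule image_subsetI)
    fix x
    obtain y where "\<forall>b\<in>{1..n} \<times> {..<K}. sqdist p b x = sqdist q b y \<and>
        (\<Sum>j\<in>block b. (x j)\<^sup>2) = (\<Sum>j\<in>block b. (y j)\<^sup>2)"
      using exists_reflection[OF pq] by blast
    from avg[OF this] show "average p x \<in> range (average q)" by (simp only: rangeI)
  qed
  have "range (average p) = range (average q)" using sub assms by blast
  moreover have "average p (\<lambda>_. 0) = average q (\<lambda>_. 0)"
    using assms by (intro avg) (auto simp: centered_def sqdist_def)
  ultimately show ?thesis by (simp add: gap_def)
qed

definition component :: "point \<Rightarrow> point \<Rightarrow> real \<Rightarrow> real \<Rightarrow> nat \<Rightarrow> point \<Rightarrow> real" where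
  "component p x0 \<alpha> \<beta> i x = \<alpha> * chain p i (\<lambda>j. (x j - x0 j) / \<beta>)"

text \<open>
  The gradient of a component, if only the links up to \<open>c\<close> are present.  The minimum lets \<open>c\<close> be any
  number of visits.
\<close>

definition reply :: "point \<Rightarrow> point \<Rightarrow> real \<Rightarrow> real \<Rightarrow> nat \<Rightarrow> nat \<Rightarrow> point \<Rightarrow> point" where
  "reply p x0 \<alpha> \<beta> c i x = (\<lambda>j\<in>{..<d}. \<alpha> / \<beta> * chain_grad p (min c (K - 1)) i (\<lambda>j. (x j - x0 j) / \<beta>) j)"

lemma has_gradient_component:
  "\<beta> > 0 \<Longrightarrow> has_gradient d (component p x0 \<alpha> \<beta> i) (reply p x0 \<alpha> \<beta> (K - 1) i x) x"
  unfolding component_def reply_def using has_gradient_affine[OF tangent_approx_chain] by simp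

lemma grad_component: "\<beta> > 0 \<Longrightarrow> grad d (component p x0 \<alpha> \<beta> i) x = reply p x0 \<alpha> \<beta> (K - 1) i x"
  by (intro grad_eqI has_gradient_component)

lemma finite_sum_component: "finite_sum n (component p x0 \<alpha> \<beta>) x = \<alpha> * average p (\<lambda>j. (x j - x0 j) / \<beta>)"
  by (simp add: finite_sum_def component_def average_def sum_distrib_left)

lemma grad_finite_sum:
  assumes "\<beta> > 0"
  shows "grad d (finite_sum n (component p x0 \<alpha> \<beta>)) x =
    (\<lambda>j\<in>{..<d}. \<alpha> / \<beta> * ((1 / n) * (\<Sum>i=1..n. chain_grad p (K - 1) i (\<lambda>j. (x j - x0 j) / \<beta>) j)))"
proof -
  have "tangent_approx d (\<lambda>x. (1 / n) * (\<Sum>i\<in>{1..n}. chain p i x)) (\<lambda>j. (1 / n) * (\<Sum>i\<in>{1..n}. chain_grad p (K - 1) i z j)) z" for z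
    by (intro tangent_approx_cmult tangent_approx_sum tangent_approx_chain) simp
  moreover have "finite_sum n (component p x0 \<alpha> \<beta>) = (\<lambda>x. \<alpha> * ((1 / n) * (\<Sum>i\<in>{1..n}. chain p i (\<lambda>j. (x j - x0 j) / \<beta>))))"
    by (simp add: fun_eq_iff finite_sum_component average_def)
  ultimately show ?thesis
    using assms by (intro grad_eqI) (simp only:, rule has_gradient_affine)
qed

lemma average_cong: "(\<And>j. j < d \<Longrightarrow> x j = y j) \<Longrightarrow> average p x = average p y"
proof -
  assume "\<And>j. j < d \<Longrightarrow> x j = y j"
  then have "chain p i x = chain p i y" if "i \<in> {1..n}" for i
    using that by (intro chain_eqI) (auto simp: sqdist_def block_def)
  then show ?thesis by (simp add: average_def)
qed

lemma initial_gap_component: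
  assumes "centered p" and \<Delta>: "\<Delta> > 0" and \<beta>: "\<beta> > 0"
  shows "initial_gap d (finite_sum n (component p x0 (\<Delta> / gap p) \<beta>)) x0 \<Delta>"
proof -
  define \<alpha> where "\<alpha> = \<Delta> / gap p"
  have \<alpha>: "\<alpha> > 0" using gap_pos[OF assms(1)] \<Delta> by (simp add: \<alpha>_def)
  let ?f = "finite_sum n (component p x0 \<alpha> \<beta>)"
  let ?I = "INF x. average p x"
  have lower: "\<alpha> * ?I \<le> ?f x" for x
    using \<alpha> by (simp add: finite_sum_component cINF_lower[OF bdd_below_average])
  have "(INF x\<in>space (Rd d). ?f x) = \<alpha> * ?I"
  proof (rule cInf_eq_non_empty)
    show "?f ` space (Rd d) \<noteq> {}" by (simp add: Rd_def space_PiM PiE_eq_empty_iff)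
    show "\<alpha> * ?I \<le> v" if "v \<in> ?f ` space (Rd d)" for v using that lower by auto
    fix w assume w: "\<And>v. v \<in> ?f ` space (Rd d) \<Longrightarrow> w \<le> v"
    have "w / \<alpha> \<le> average p z" for z
    proof -
      define x where "x = (\<lambda>j\<in>{..<d}. x0 j + \<beta> * z j)"
      have "x \<in> space (Rd d)" by (simp add: x_def Rd_def space_PiM)
      then have "w \<le> ?f x" using w by blast
      also have "?f x = \<alpha> * average p z"
        unfolding finite_sum_component using \<beta> by (intro arg_cong[where f = "\<lambda>t. \<alpha> * t"] average_cong) (auto simp: x_def)
      finally show ?thesis using \<alpha> by (simp add: field_simps)
    qed
    then have "w / \<alpha> \<le> ?I" by (intro cINF_greatest) auto
    then show "w \<le> \<alpha> * ?I" using \<alpha> by (simp add: field_simps)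
  qed
  moreover have "?f x0 = \<alpha> * average p (\<lambda>_. 0)" by (simp add: finite_sum_component)
  moreover have "\<alpha> * average p (\<lambda>_. 0) - \<alpha> * ?I = \<Delta>"
  proof -
    have "\<alpha> * gap p = \<Delta>" using gap_pos[OF assms(1)] by (simp add: \<alpha>_def)
    then show ?thesis by (simp add: gap_def right_diff_distrib)
  qed
  moreover have "bdd_below (?f ` space (Rd d))" using lower by (intro bdd_belowI2)
  ultimately show ?thesis by (simp add: initial_gap_def \<alpha>_def)
qed

lemma averaged_lipschitz_component:
  assumes \<alpha>: "\<alpha> > 0" and L: "L > 0" and \<beta>: "\<beta> > 0" and scale: "\<beta>\<^sup>2 = 384 * \<alpha> / (sqrt n * L)"
  shows "averaged_lipschitz_gradient n d (component p x0 \<alpha> \<beta>) L"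
  unfolding averaged_lipschitz_gradient_def
proof (intro conjI ballI)
  fix i x show "\<exists>g. has_gradient d (component p x0 \<alpha> \<beta> i) g x"
    using has_gradient_component[OF \<beta>] by blast
next
  fix x y
  let ?z = "\<lambda>x j. (x j - x0 j) / \<beta>"
  have dist: "(edist d (grad d (component p x0 \<alpha> \<beta> i) x) (grad d (component p x0 \<alpha> \<beta> i) y))\<^sup>2 =
      (\<alpha> / \<beta>)\<^sup>2 * (\<Sum>j<d. (chain_grad p (K - 1) i (?z x) j - chain_grad p (K - 1) i (?z y) j)\<^sup>2)" for i
    unfolding edist_sq sum_distrib_left power_mult_distrib[symmetric]
    by (intro sum.cong) (auto simp: grad_component[OF \<beta>] reply_def right_diff_distrib)
  have "(\<Sum>i=1..n. (edist d (grad d (component p x0 \<alpha> \<beta> i) x) (grad d (component p x0 \<alpha> \<beta> i) y))\<^sup>2)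
      = (\<alpha> / \<beta>)\<^sup>2 * (\<Sum>i=1..n. \<Sum>j<d. (chain_grad p (K - 1) i (?z x) j - chain_grad p (K - 1) i (?z y) j)\<^sup>2)"
    by (simp only: dist sum_distrib_left)
  also have "\<dots> \<le> (\<alpha> / \<beta>)\<^sup>2 * (384\<^sup>2 * (\<Sum>j<d. (?z x j - ?z y j)\<^sup>2))"
    by (intro mult_left_mono chain_grad_lipschitz) simp
  also have "(\<Sum>j<d. (?z x j - ?z y j)\<^sup>2) = (edist d x y / \<beta>)\<^sup>2"
    using edist_affine[OF \<beta>, of d x x0 y] by (simp flip: edist_sq)
  also have "(\<alpha> / \<beta>)\<^sup>2 * (384\<^sup>2 * (edist d x y / \<beta>)\<^sup>2) = (384 * \<alpha> / \<beta>\<^sup>2)\<^sup>2 * (edist d x y)\<^sup>2"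
    using \<beta> by (simp add: power2_eq_square field_simps)
  also have "384 * \<alpha> / \<beta>\<^sup>2 = sqrt n * L"
    unfolding scale using \<alpha> L n_pos by (simp add: field_simps)
  finally show "(\<Sum>i=1..n. (edist d (grad d (component p x0 \<alpha> \<beta> i) x) (grad d (component p x0 \<alpha> \<beta> i) y))\<^sup>2) / real n
      \<le> L\<^sup>2 * (edist d x y)\<^sup>2"
    using n_pos by (simp add: field_simps power_mult_distrib)
qed

lemma large_average_gradient:
  assumes \<alpha>: "\<alpha> > 0" and L: "L > 0" and \<beta>: "\<beta> > 0" and scale: "\<beta>\<^sup>2 = 384 * \<alpha> / (sqrt n * L)"
    and p: "centered p" and U: "U \<subseteq> {1..n}" "n < 2 * card U"
    and far: "\<And>i. i \<in> U \<Longrightarrow> \<exists>k<K. 1/4 < sqdist p (i, k) (\<lambda>j. (x j - x0 j) / \<beta>)"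
  shows "\<alpha> * L / (sqrt n * (768 * 163840)) < (enorm d (grad d (finite_sum n (component p x0 \<alpha> \<beta>)) x))\<^sup>2"
proof -
  define z where "z = (\<lambda>j. (x j - x0 j) / \<beta>)"
  define g where "g = (\<lambda>i. chain_grad p (K - 1) i z)"
  \<comment> \<open>The chains live on disjoint coordinates, so their gradients are orthogonal.\<close>
  have single: "(\<Sum>i=1..n. g i j)\<^sup>2 = (\<Sum>i=1..n. (g i j)\<^sup>2)" if j: "j < d" for j
  proof -
    have i0: "fst (pos j) \<in> {1..n}" using pos_in[OF j] by (simp add: mem_Times_iff)
    have "(\<Sum>i=1..n. g i j) = (\<Sum>i=1..n. if i = fst (pos j) then g (fst (pos j)) j else 0)"
      by (intro sum.cong) (auto simp: g_def chain_grad_def)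
    moreover have "(\<Sum>i=1..n. (g i j)\<^sup>2) = (\<Sum>i=1..n. if i = fst (pos j) then (g (fst (pos j)) j)\<^sup>2 else 0)"
      by (intro sum.cong) (auto simp: g_def chain_grad_def)
    ultimately show ?thesis using i0 by simp
  qed
  have "real n / 2 < real (card U)" using U(2) by linarith
  then have "(1/163840) * (real n / 2) < (\<Sum>i\<in>U. 1/163840)" by simp
  also have "\<dots> \<le> (\<Sum>i\<in>U. \<Sum>j<d. (g i j)\<^sup>2)"
  proof (rule sum_mono)
    fix i assume i: "i \<in> U"
    obtain k where "k < K" "1/4 < sqdist p (i, k) z" using far[OF i] by (auto simp: z_def)
    then show "1/163840 \<le> (\<Sum>j<d. (g i j)\<^sup>2)"
      unfolding g_def using U(1) i p by (intro large_gradient) (auto simp: centered_def)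
  qed
  also have "\<dots> \<le> (\<Sum>i=1..n. \<Sum>j<d. (g i j)\<^sup>2)"
    using U(1) by (intro sum_mono2) (auto intro: sum_nonneg)
  finally have big: "real n / (2 * 163840) < (\<Sum>i=1..n. \<Sum>j<d. (g i j)\<^sup>2)" by simp
  have "(enorm d (grad d (finite_sum n (component p x0 \<alpha> \<beta>)) x))\<^sup>2 =
      (\<Sum>j<d. (\<alpha> / \<beta> * ((1 / n) * (\<Sum>i=1..n. g i j)))\<^sup>2)"
    unfolding enorm_def L2_set_sq by (intro sum.cong) (auto simp: grad_finite_sum[OF \<beta>] g_def z_def)
  also have "\<dots> = (\<Sum>j<d. (\<alpha> / \<beta>)\<^sup>2 / n\<^sup>2 * (\<Sum>i=1..n. (g i j)\<^sup>2))"
    by (intro sum.cong refl) (simp only: single[symmetric] lessThan_iff power_mult_distrib power_divide, simp)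
  also have "\<dots> = (\<alpha> / \<beta>)\<^sup>2 / n\<^sup>2 * (\<Sum>i=1..n. \<Sum>j<d. (g i j)\<^sup>2)"
    unfolding sum_distrib_left[symmetric] by (subst sum.swap) simp
  finally have norm: "(enorm d (grad d (finite_sum n (component p x0 \<alpha> \<beta>)) x))\<^sup>2 =
      (\<alpha> / \<beta>)\<^sup>2 / n\<^sup>2 * (\<Sum>i=1..n. \<Sum>j<d. (g i j)\<^sup>2)" .
  have ab: "(\<alpha> / \<beta>)\<^sup>2 = \<alpha> * (sqrt n * L) / 384"
    unfolding power_divide scale using \<alpha> L n_pos by (simp add: power2_eq_square field_simps)
  have "0 < (\<alpha> / \<beta>)\<^sup>2 / n\<^sup>2" using \<alpha> \<beta> n_pos by simp
  then have "(\<alpha> / \<beta>)\<^sup>2 / n\<^sup>2 * (real n / (2 * 163840)) < (enorm d (grad d (finite_sum n (component p x0 \<alpha> \<beta>)) x))\<^sup>2"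
    unfolding norm using big by (intro mult_strict_left_mono)
  moreover have "(\<alpha> / \<beta>)\<^sup>2 / n\<^sup>2 * (real n / (2 * 163840)) = \<alpha> * L / (sqrt n * (768 * 163840))"
  proof -
    define s where "s = sqrt n"
    have "real n = s * s" and s: "s > 0" using n_pos by (simp_all add: s_def)
    then show ?thesis unfolding ab s_def[symmetric] by (simp add: power2_eq_square field_simps)
  qed
  ultimately show ?thesis by simp
qed

end

section \<open>A code of hidden centres\<close>

text \<open>
  The word for \<open>w\<close> has two ones in each block, at offset \<open>fst w\<close> of the first half and at offset \<open>snd w\<close>
  of the second half.  Two halves are used because \<open>m\<close> coordinates with a single one would give only
  \<open>m\<close> words per block, too few for the dimension bound.
\<close>

lemma exists_code:
  fixes n K m :: nat
  assumes "0 < n" "0 < K" "0 < m"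
  defines "d \<equiv> n * K * (2 * m)" and "W \<equiv> {..<m} \<times> {..<m}"
  obtains pos :: "nat \<Rightarrow> nat \<times> nat" and word :: "nat \<times> nat \<Rightarrow> nat \<Rightarrow> real"
  where "chains d n K pos"
    and "\<And>b w. b \<in> {1..n} \<times> {..<K} \<Longrightarrow> w \<in> W \<Longrightarrow> (\<Sum>j\<in>{j. j < d \<and> pos j = b}. (word w j)\<^sup>2) = 2"
    and "\<And>b w w'. b \<in> {1..n} \<times> {..<K} \<Longrightarrow> w \<in> W \<Longrightarrow> w' \<in> W \<Longrightarrow> w \<noteq> w' \<Longrightarrow>
      2 \<le> (\<Sum>j\<in>{j. j < d \<and> pos j = b}. (word w j - word w' j)\<^sup>2)"
proof -
  have "card {..<d} = card (({1..n} \<times> {..<K}) \<times> {..<2 * m})"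
    by (simp add: d_def card_cartesian_product)
  then obtain h where h: "bij_betw h {..<d} (({1..n} \<times> {..<K}) \<times> {..<2 * m})"
    using finite_same_card_bij[of "{..<d}" "({1..n} \<times> {..<K}) \<times> {..<2 * m}"] by auto
  define pos where "pos j = fst (h j)" for j
  define v :: "nat \<times> nat \<Rightarrow> nat \<Rightarrow> real" where "v w r = (if r = fst w \<or> r = m + snd w then 1 else 0)" for w r
  define word where "word w j = v w (snd (h j))" for w j
  have range: "h j \<in> ({1..n} \<times> {..<K}) \<times> {..<2 * m}" if "j < d" for j
    using h that by (auto simp: bij_betw_def)
  have sum: "(\<Sum>j\<in>{j. j < d \<and> pos j = b}. f (snd (h j))) = (\<Sum>r<2 * m. f r)"
    if b: "b \<in> {1..n} \<times> {..<K}" for b and f :: "nat \<Rightarrow> real"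
  proof (rule sum.reindex_bij_betw)
    show "bij_betw (\<lambda>j. snd (h j)) {j. j < d \<and> pos j = b} {..<2 * m}"
      unfolding bij_betw_def
    proof (intro conjI equalityI subsetI inj_onI)
      fix j j' assume "j \<in> {j. j < d \<and> pos j = b}" "j' \<in> {j. j < d \<and> pos j = b}" "snd (h j) = snd (h j')"
      then show "j = j'" using h by (auto simp: bij_betw_def pos_def inj_on_def prod_eq_iff)
    next
      fix r assume "r \<in> {..<2 * m}"
      then have "(b, r) \<in> h ` {..<d}" using h b by (simp add: bij_betw_def)
      then obtain j where "j < d" "h j = (b, r)" by auto
      then show "r \<in> (\<lambda>j. snd (h j)) ` {j. j < d \<and> pos j = b}" by (force simp: pos_def)
    next
      fix r assume "r \<in> (\<lambda>j. snd (h j)) ` {j. j < d \<and> pos j = b}"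
      then show "r \<in> {..<2 * m}" using range by (auto simp: mem_Times_iff)
    qed
  qed
  show ?thesis
  proof (rule that[of pos word])
    show "chains d n K pos"
      using assms range by unfold_locales (auto simp: pos_def mem_Times_iff)
  next
    fix b w assume b: "b \<in> {1..n} \<times> {..<K}" and w: "w \<in> W"
    have sub: "{fst w, m + snd w} \<subseteq> {..<2 * m}" and ne: "fst w \<noteq> m + snd w" using w by (auto simp: W_def)
    have "(\<Sum>j\<in>{j. j < d \<and> pos j = b}. (word w j)\<^sup>2) = (\<Sum>r<2 * m. (v w r)\<^sup>2)"
      unfolding word_def by (rule sum[OF b])
    also have "\<dots> = (\<Sum>r\<in>{fst w, m + snd w}. (v w r)\<^sup>2)"
      using sub by (intro sum.mono_neutral_right) (auto simp: v_def)
    also have "\<dots> = 2" using ne by (simp add: v_def)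
    finally show "(\<Sum>j\<in>{j. j < d \<and> pos j = b}. (word w j)\<^sup>2) = 2" .
  next
    fix b w w' assume b: "b \<in> {1..n} \<times> {..<K}" and w: "w \<in> W" "w' \<in> W" "w \<noteq> w'"
    obtain r r' where r: "r \<noteq> r'" "r < 2 * m" "r' < 2 * m" "\<bar>v w r - v w' r\<bar> = 1" "\<bar>v w r' - v w' r'\<bar> = 1"
    proof (cases "fst w = fst w'")
      case False
      then show ?thesis using that[of "fst w" "fst w'"] w by (auto simp: W_def v_def)
    next
      case True
      then have "snd w \<noteq> snd w'" using w by (auto simp: prod_eq_iff)
      then show ?thesis using that[of "m + snd w" "m + snd w'"] w by (auto simp: W_def v_def)
    qed
    have sq: "(v w r - v w' r)\<^sup>2 = 1" "(v w r' - v w' r')\<^sup>2 = 1"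
      using r(4,5) power2_abs[of "v w r - v w' r"] power2_abs[of "v w r' - v w' r'"] by simp_all
    have "2 = (\<Sum>r\<in>{r, r'}. (v w r - v w' r)\<^sup>2)" using r(1) sq by simp
    also have "\<dots> \<le> (\<Sum>r<2 * m. (v w r - v w' r)\<^sup>2)" using r by (intro sum_mono2) auto
    also have "\<dots> = (\<Sum>j\<in>{j. j < d \<and> pos j = b}. (word w j - word w' j)\<^sup>2)"
      unfolding word_def by (rule sum[OF b, symmetric])
    finally show "2 \<le> (\<Sum>j\<in>{j. j < d \<and> pos j = b}. (word w j - word w' j)\<^sup>2)" .
  qed
qed

lemma unique_nearest_word:
  fixes x u v :: "nat \<Rightarrow> real"
  assumes "2 \<le> (\<Sum>j\<in>S. (u j - v j)\<^sup>2)"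
    and "(\<Sum>j\<in>S. (x j - u j)\<^sup>2) < 1/2" and "(\<Sum>j\<in>S. (x j - v j)\<^sup>2) < 1/2"
  shows False
proof -
  have "(u j - v j)\<^sup>2 \<le> 2 * (x j - u j)\<^sup>2 + 2 * (x j - v j)\<^sup>2" for j
  proof -
    have "0 \<le> (2 * x j - u j - v j)\<^sup>2" by simp
    then show ?thesis by (simp add: power2_eq_square algebra_simps)
  qed
  then have "(\<Sum>j\<in>S. (u j - v j)\<^sup>2) \<le> (\<Sum>j\<in>S. 2 * (x j - u j)\<^sup>2 + 2 * (x j - v j)\<^sup>2)" by (intro sum_mono)
  also have "\<dots> = 2 * (\<Sum>j\<in>S. (x j - u j)\<^sup>2) + 2 * (\<Sum>j\<in>S. (x j - v j)\<^sup>2)"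
    by (simp add: sum.distrib sum_distrib_left)
  finally show False using assms by simp
qed

section \<open>Measurability of the trajectory\<close>

text \<open>
  The measure of a nonmeasurable set is \<open>0\<close> by convention, so the lower bound on the probability needs
  the trajectory to be a measurable function of the seed.
\<close>

lemma measurable_observed:
  assumes A: "stochastic_first_order n d A"
    and grad: "\<And>i. i \<in> {1..n} \<Longrightarrow> grad d (F i) \<in> Rd d \<rightarrow>\<^sub>M Rd d"
  shows "(\<lambda>\<xi>. observed d A F \<xi> k) \<in> seed \<rightarrow>\<^sub>M (\<Pi>\<^sub>M l\<in>{..<k}. Rd d)"
    and "(\<lambda>\<xi>. A k (\<xi>, observed d A F \<xi> k)) \<in> seed \<rightarrow>\<^sub>M (Rd d \<Otimes>\<^sub>M count_space {1..n})"
proof -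
  have query: "(\<lambda>\<xi>. A k (\<xi>, observed d A F \<xi> k)) \<in> seed \<rightarrow>\<^sub>M (Rd d \<Otimes>\<^sub>M count_space {1..n})"
    if "(\<lambda>\<xi>. observed d A F \<xi> k) \<in> seed \<rightarrow>\<^sub>M (\<Pi>\<^sub>M l\<in>{..<k}. Rd d)" for k
  proof -
    have "(\<lambda>\<xi>. (\<xi>, observed d A F \<xi> k)) \<in> seed \<rightarrow>\<^sub>M (seed \<Otimes>\<^sub>M (\<Pi>\<^sub>M l\<in>{..<k}. Rd d))"
      by (rule measurable_Pair[OF _ that]) simp
    moreover have "A k \<in> (seed \<Otimes>\<^sub>M (\<Pi>\<^sub>M l\<in>{..<k}. Rd d)) \<rightarrow>\<^sub>M (Rd d \<Otimes>\<^sub>M count_space {1..n})"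
      using A by (simp add: stochastic_first_order_def)
    ultimately show ?thesis by (rule measurable_compose)
  qed
  show obs: "(\<lambda>\<xi>. observed d A F \<xi> k) \<in> seed \<rightarrow>\<^sub>M (\<Pi>\<^sub>M l\<in>{..<k}. Rd d)"
  proof (induction k)
    case 0
    show ?case by (simp add: PiM_empty space_PiM)
  next
    case (Suc k)
    let ?q = "\<lambda>\<xi>. A k (\<xi>, observed d A F \<xi> k)"
    have q: "?q \<in> seed \<rightarrow>\<^sub>M (Rd d \<Otimes>\<^sub>M count_space {1..n})" by (rule query[OF Suc])
    have "(\<lambda>\<xi>. grad d (F (snd (?q \<xi>))) (fst (?q \<xi>))) \<in> seed \<rightarrow>\<^sub>M Rd d"
    proof (rule measurable_compose_countable'[where f = "\<lambda>i \<xi>. grad d (F i) (fst (?q \<xi>))" and g = "\<lambda>\<xi>. snd (?q \<xi>)" and I = "{1..n}"])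
      show "(\<lambda>\<xi>. grad d (F i) (fst (?q \<xi>))) \<in> seed \<rightarrow>\<^sub>M Rd d" if "i \<in> {1..n}" for i
        by (rule measurable_compose[OF measurable_compose[OF q measurable_fst] grad[OF that]])
      show "(\<lambda>\<xi>. snd (?q \<xi>)) \<in> seed \<rightarrow>\<^sub>M count_space {1..n}"
        by (rule measurable_compose[OF q measurable_snd])
    qed simp
    then have "(\<lambda>\<xi>. (observed d A F \<xi> k)(k := grad d (F (snd (?q \<xi>))) (fst (?q \<xi>)))) \<in> seed \<rightarrow>\<^sub>M (\<Pi>\<^sub>M l\<in>{..<Suc k}. Rd d)"
      by (intro measurable_fun_upd[where J = "{..<k}"] Suc) auto
    then show ?case by (simp add: case_prod_beta fun_upd_def)
  qed
  show "(\<lambda>\<xi>. A k (\<xi>, observed d A F \<xi> k)) \<in> seed \<rightarrow>\<^sub>M (Rd d \<Otimes>\<^sub>M count_space {1..n})"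
    by (rule query[OF obs])
qed

lemma measurable_enorm: "enorm d \<in> borel_measurable (Rd d)"
  unfolding enorm_def L2_set_def Rd_def by measurable

lemma sets_costs_at_least:
  assumes A: "stochastic_first_order n d A"
    and grad: "\<And>i. i \<in> {1..n} \<Longrightarrow> grad d (F i) \<in> Rd d \<rightarrow>\<^sub>M Rd d"
    and avg: "grad d (finite_sum n F) \<in> Rd d \<rightarrow>\<^sub>M Rd d"
  shows "costs_at_least n d A F \<epsilon> T \<in> sets seed"
proof -
  have [measurable]: "(\<lambda>\<xi>. enorm d (grad d (finite_sum n F) (iterate d A F \<xi> k))) \<in> borel_measurable seed" for k
    unfolding iterate_def
    using measurable_observed(2)[OF A grad, where k = k]
    by (intro measurable_compose[OF _ measurable_enorm] measurable_compose[OF _ avg] measurable_compose[OF _ measurable_fst])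
  show ?thesis unfolding costs_at_least_def by measurable
qed

lemma prob_space_seed: "prob_space seed"
  by (rule prob_space_uniform_measure) auto

context chains begin

lemma measurable_chain_grad:
  assumes "j < d"
  shows "(\<lambda>x. chain_grad p c i (\<lambda>j. (x j - x0 j) / \<beta>) j) \<in> borel_measurable (Rd d)"
proof -
  have coord [measurable]: "(\<lambda>x. x j) \<in> borel_measurable (Rd d)" if "j < d" for j
    unfolding Rd_def using that by (intro measurable_component_singleton) simp
  have "(\<lambda>x. \<Sum>j\<in>block b. ((x j - x0 j) / \<beta> - p j)\<^sup>2) \<in> borel_measurable (Rd d)" for b
    by (intro borel_measurable_sum borel_measurable_power borel_measurable_diff borel_measurable_divide
      borel_measurable_const coord) (auto simp: block_def)
  then have [measurable]: "(\<lambda>x. sqdist p b (\<lambda>j. (x j - x0 j) / \<beta>)) \<in> borel_measurable (Rd d)" for b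
    by (simp add: sqdist_def)
  have [measurable]: "(\<lambda>x. x j) \<in> borel_measurable (Rd d)" by (rule coord[OF assms])
  show ?thesis
    unfolding chain_grad_def pull_def entry_def reward_def hat_def by measurable
qed

lemma measurable_reply: "reply p x0 \<alpha> \<beta> c i \<in> Rd d \<rightarrow>\<^sub>M Rd d"
proof -
  have "reply p x0 \<alpha> \<beta> c i \<in> Rd d \<rightarrow>\<^sub>M (\<Pi>\<^sub>M j\<in>{..<d}. borel)"
    unfolding reply_def[abs_def]
    by (intro measurable_restrict borel_measurable_times borel_measurable_const measurable_chain_grad) auto
  then show ?thesis by (simp add: Rd_def)
qed

lemma measurable_grad_finite_sum:
  assumes "\<beta> > 0"
  shows "grad d (finite_sum n (component p x0 \<alpha> \<beta>)) \<in> Rd d \<rightarrow>\<^sub>M Rd d"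
proof -
  have "grad d (finite_sum n (component p x0 \<alpha> \<beta>)) \<in> Rd d \<rightarrow>\<^sub>M (\<Pi>\<^sub>M j\<in>{..<d}. borel)"
    unfolding grad_finite_sum[OF assms, abs_def]
    by (intro measurable_restrict borel_measurable_times borel_measurable_const borel_measurable_sum measurable_chain_grad) auto
  then show ?thesis by (simp add: Rd_def)
qed

end

section \<open>The resisting instance\<close>

context chains begin

lemma reply_cong:
  assumes "\<And>j. j < d \<Longrightarrow> fst (pos j) = i \<Longrightarrow> snd (pos j) \<le> c \<Longrightarrow> p j = q j"
  shows "reply p x0 \<alpha> \<beta> c i x = reply q x0 \<alpha> \<beta> c i x"
  unfolding reply_def
  by (intro restrict_ext arg_cong[where f = "\<lambda>t. _ * t"] chain_grad_cong) (use assms in auto)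

lemma reply_unlucky:
  assumes "\<And>k. c \<le> k \<Longrightarrow> k < K \<Longrightarrow> 1/2 \<le> sqdist p (i, k) (\<lambda>j. (x j - x0 j) / \<beta>)"
  shows "reply p x0 \<alpha> \<beta> c i x = reply p x0 \<alpha> \<beta> (K - 1) i x"
proof (cases "c < K")
  case True
  then have min: "min c (K - 1) = c" by simp
  show ?thesis
    unfolding reply_def min min.idem
    by (intro restrict_ext) (simp only: chain_grad_unlucky[OF assms True] lessThan_iff)
next
  case False
  then show ?thesis by (simp add: reply_def)
qed

text \<open>
  The words in \<open>W\<close> are the candidate centres of every block.  Every assignment \<open>\<sigma>\<close> of words to blocks
  on which no query is lucky forces the cost \<open>T\<close>; at most a fraction \<open>\<delta>\<close> of the assignments has a
  lucky query.
\<close>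

lemma resisting_instance:
  fixes word :: "'w \<Rightarrow> point" and x0 :: point
  assumes A: "stochastic_first_order n d A"
    and \<alpha>: "\<alpha> > 0" and L: "L > 0" and \<beta>: "\<beta> > 0" and scale: "\<beta>\<^sup>2 = 384 * \<alpha> / (sqrt n * L)"
    and W: "finite W" "W \<noteq> {}"
    and word_norm: "\<And>b w. b \<in> {1..n} \<times> {..<K} \<Longrightarrow> w \<in> W \<Longrightarrow> (\<Sum>j\<in>block b. (word w j)\<^sup>2) = 2"
    and word_apart: "\<And>b w w'. b \<in> {1..n} \<times> {..<K} \<Longrightarrow> w \<in> W \<Longrightarrow> w' \<in> W \<Longrightarrow> w \<noteq> w' \<Longrightarrow>
      2 \<le> (\<Sum>j\<in>block b. (word w j - word w' j)\<^sup>2)"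
    and many: "(real n * real K)\<^sup>2 \<le> \<delta> * real (card W)"
    and \<epsilon>: "\<epsilon> > 0" "\<epsilon>\<^sup>2 \<le> \<alpha> * L / (sqrt n * (768 * 163840))"
    and T: "2 * T \<le> real n * real K"
  shows "\<exists>p. centered p \<and> measure seed (costs_at_least n d A (component p x0 \<alpha> \<beta>) \<epsilon> T) \<ge> 1 - \<delta>"
proof -
  interpret prob_space seed by (rule prob_space_seed)
  define I where "I = {1..n} \<times> {..<K}"
  have I: "finite I" "card I = n * K" by (simp_all add: I_def card_cartesian_product)
  define center where "center \<sigma> j = word (\<sigma> (pos j)) j" for \<sigma> j
  define G where "G \<sigma> = reply (center \<sigma>) x0 \<alpha> \<beta>" for \<sigma>
  define Q where "Q \<xi> = (\<lambda>t h. A t (\<xi>, h))" for \<xi>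
  define z where "z x = (\<lambda>j. (x j - x0 j) / \<beta>)" for x :: point
  define lucky where "lucky b w x \<longleftrightarrow> (\<Sum>j\<in>block b. (z x j - word w j)\<^sup>2) < 1/2" for b w x
  define F where "F \<sigma> = component (center \<sigma>) x0 \<alpha> \<beta>" for \<sigma>
  have sqdist_center: "sqdist (center \<sigma>) b x = (\<Sum>j\<in>block b. (x j - word (\<sigma> b) j)\<^sup>2)" for \<sigma> b x
    unfolding sqdist_def by (intro sum.cong) (auto simp: center_def block_def)
  have centered: "centered (center \<sigma>)" if "\<sigma> \<in> I \<rightarrow>\<^sub>E W" for \<sigma>
    unfolding centered_def
  proof
    fix b assume b: "b \<in> {1..n} \<times> {..<K}"
    have "(\<Sum>j\<in>block b. (center \<sigma> j)\<^sup>2) = (\<Sum>j\<in>block b. (word (\<sigma> b) j)\<^sup>2)"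
      by (intro sum.cong) (auto simp: center_def block_def)
    then show "(\<Sum>j\<in>block b. (center \<sigma> j)\<^sup>2) = 2"
      using word_norm[OF b, of "\<sigma> b"] that b by (auto simp: I_def)
  qed
  have local: "G \<sigma> c i x = G \<sigma>' c i x" if "\<And>k. k \<le> c \<Longrightarrow> \<sigma> (i, k) = \<sigma>' (i, k)" for \<sigma> \<sigma>' c i x
    unfolding G_def
  proof (rule reply_cong)
    fix j assume "fst (pos j) = i" "snd (pos j) \<le> c"
    then show "center \<sigma> j = center \<sigma>' j"
      using that[of "snd (pos j)"] by (simp add: center_def) (metis prod.collapse)
  qed
  have unique: "w = w'" if "b \<in> I" "w \<in> W" "w' \<in> W" "lucky b w x" "lucky b w' x" for b w w' x
    using unique_nearest_word[of "word w" "word w'" "block b" "z x"] word_apart[of b w w'] that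
    by (auto simp: I_def lucky_def)
  have agree: "G \<sigma> c i x = G \<sigma> (K - 1) i x"
    if "\<And>k. (i, k) \<in> I \<Longrightarrow> c \<le> k \<Longrightarrow> \<not> lucky (i, k) (\<sigma> (i, k)) x" for \<sigma> c i x
  proof (cases "i \<in> {1..n}")
    case True
    then show ?thesis
      unfolding G_def using that
      by (intro reply_unlucky) (auto simp: sqdist_center lucky_def I_def z_def not_less)
  next
    case False
    then have "fst (pos j) \<noteq> i" if "j < d" for j using pos_in[OF that] by (auto simp: mem_Times_iff)
    then show ?thesis unfolding G_def reply_def by (intro restrict_ext) (auto simp: chain_grad_def)
  qed
  define Bad where "Bad \<sigma> = space seed - costs_at_least n d A (F \<sigma>) \<epsilon> T" for \<sigma>
  have good: "costs_at_least n d A (F \<sigma>) \<epsilon> T \<in> events" for \<sigma>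
  proof (rule sets_costs_at_least[OF A])
    show "grad d (F \<sigma> i) \<in> Rd d \<rightarrow>\<^sub>M Rd d" for i
      using measurable_reply[of "center \<sigma>" x0 \<alpha> \<beta> "K - 1" i] by (simp add: F_def grad_component[OF \<beta>, abs_def])
    show "grad d (finite_sum n (F \<sigma>)) \<in> Rd d \<rightarrow>\<^sub>M Rd d"
      unfolding F_def by (rule measurable_grad_finite_sum[OF \<beta>])
  qed
  have bad_lucky: "\<exists>t<n * K. \<exists>b\<in>I. visits (Q \<xi>) (G \<sigma>) t (fst b) \<le> snd b \<and>
      lucky b (\<sigma> b) (query_point (Q \<xi>) (G \<sigma>) t)"
    if \<sigma>: "\<sigma> \<in> I \<rightarrow>\<^sub>E W" and bad: "\<xi> \<in> Bad \<sigma>" for \<xi> \<sigma>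
  proof (rule ccontr)
    assume "\<not> ?thesis"
    then have unlucky: "\<not> lucky b (\<sigma> b) (query_point (Q \<xi>) (G \<sigma>) t)"
      if "t < n * K" "b \<in> I" "visits (Q \<xi>) (G \<sigma>) t (fst b) \<le> snd b" for t b using that by blast
    obtain t where small: "enorm d (grad d (finite_sum n (F \<sigma>)) (iterate d A (F \<sigma>) \<xi> t)) \<le> \<epsilon>" and "real t < T"
      using bad unfolding Bad_def costs_at_least_def by force
    then have "real (2 * t) < real (n * K)" using T by simp
    then have t: "2 * t < n * K" by (simp only: of_nat_less_iff)
    have "transcript (Q \<xi>) (G \<sigma>) t = transcript (Q \<xi>) (\<lambda>_. G \<sigma> (K - 1)) t"
      by (rule transcript_eq_of_no_luck[where I = I and lucky = lucky and \<sigma> = \<sigma>])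
        (use agree unlucky t in auto)
    then have "observed d A (F \<sigma>) \<xi> t = history (Q \<xi>) (G \<sigma>) t"
      using observed_eq_history[of d "F \<sigma>" "G \<sigma> (K - 1)" A \<xi> t]
      by (simp add: F_def G_def Q_def grad_component[OF \<beta>])
    then have x: "iterate d A (F \<sigma>) \<xi> t = query_point (Q \<xi>) (G \<sigma>) t"
      by (simp add: iterate_def Q_def)
    define U where "U = {i \<in> {1..n}. visits (Q \<xi>) (G \<sigma>) t i < K}"
    have U: "n < 2 * card U"
      using card_unfinished[of "{1..n}" t K "Q \<xi>" "G \<sigma>"] t by (simp add: U_def)
    have far: "\<exists>k<K. 1/4 < sqdist (center \<sigma>) (i, k) (\<lambda>j. (iterate d A (F \<sigma>) \<xi> t j - x0 j) / \<beta>)" if "i \<in> U" for i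
    proof (intro exI conjI)
      \<comment> \<open>An unfinished chain has not been visited often enough to reveal its last centre.\<close>
      show "K - 1 < K" using K_pos by simp
      have "\<not> lucky (i, K - 1) (\<sigma> (i, K - 1)) (query_point (Q \<xi>) (G \<sigma>) t)"
        using that t K_pos by (intro unlucky) (auto simp: U_def I_def)
      then show "1/4 < sqdist (center \<sigma>) (i, K - 1) (\<lambda>j. (iterate d A (F \<sigma>) \<xi> t j - x0 j) / \<beta>)"
        by (simp add: lucky_def sqdist_center x z_def)
    qed
    have "\<alpha> * L / (sqrt n * (768 * 163840)) < (enorm d (grad d (finite_sum n (F \<sigma>)) (iterate d A (F \<sigma>) \<xi> t)))\<^sup>2"
      unfolding F_def by (rule large_average_gradient[OF \<alpha> L \<beta> scale centered[OF \<sigma>] _ U])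
        (use far in \<open>auto simp: U_def F_def\<close>)
    moreover have "(enorm d (grad d (finite_sum n (F \<sigma>)) (iterate d A (F \<sigma>) \<xi> t)))\<^sup>2 \<le> \<epsilon>\<^sup>2"
      using small by (intro power_mono) (auto simp: enorm_def L2_set_nonneg)
    ultimately show False using \<epsilon>(2) by linarith
  qed
  have N: "0 < n * K" using n_pos K_pos by simp
  have "\<exists>\<sigma>\<in>I \<rightarrow>\<^sub>E W. prob (Bad \<sigma>) \<le> \<delta>"
  proof (rule exists_good_instance[OF prob_space_seed])
    show "finite (I \<rightarrow>\<^sub>E W)" using I W by (intro finite_PiE) auto
    show "I \<rightarrow>\<^sub>E W \<noteq> {}" using W by (simp add: PiE_eq_empty_iff)
    show "Bad \<sigma> \<in> events" for \<sigma> unfolding Bad_def using good by auto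
    fix \<xi>
    let ?lucky = "{\<sigma> \<in> I \<rightarrow>\<^sub>E W. \<exists>t<n * K. \<exists>b\<in>I. visits (Q \<xi>) (G \<sigma>) t (fst b) \<le> snd b \<and>
      lucky b (\<sigma> b) (query_point (Q \<xi>) (G \<sigma>) t)}"
    have "card {\<sigma> \<in> I \<rightarrow>\<^sub>E W. \<xi> \<in> Bad \<sigma>} \<le> card ?lucky"
    proof (rule card_mono)
      show "finite ?lucky"
        by (rule finite_subset[of _ "I \<rightarrow>\<^sub>E W"]) (use I W in \<open>auto intro: finite_PiE\<close>)
      show "{\<sigma> \<in> I \<rightarrow>\<^sub>E W. \<xi> \<in> Bad \<sigma>} \<subseteq> ?lucky" using bad_lucky by blast
    qed
    also have "\<dots> \<le> (n * K) * card I * card W ^ (card I - 1)"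
      using I(1) W(1) local unique by (rule card_lucky_le)
    finally have "real (card {\<sigma> \<in> I \<rightarrow>\<^sub>E W. \<xi> \<in> Bad \<sigma>}) \<le> real ((n * K) * card I * card W ^ (card I - 1))"
      by (simp only: of_nat_le_iff)
    also have "\<dots> = (real n * real K)\<^sup>2 * real (card W) ^ (n * K - 1)" by (simp add: I power2_eq_square)
    also have "\<dots> \<le> (\<delta> * real (card W)) * real (card W) ^ (n * K - 1)"
      using many by (intro mult_right_mono) auto
    also have "\<dots> = \<delta> * real (card W) ^ (n * K)"
      using N by (simp add: power_eq_if)
    also have "\<dots> = \<delta> * real (card (I \<rightarrow>\<^sub>E W))" using I by (simp add: card_PiE)
    finally show "real (card {\<sigma> \<in> I \<rightarrow>\<^sub>E W. \<xi> \<in> Bad \<sigma>}) \<le> \<delta> * real (card (I \<rightarrow>\<^sub>E W))" .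
  qed
  then obtain \<sigma> where \<sigma>: "\<sigma> \<in> I \<rightarrow>\<^sub>E W" and bad: "prob (Bad \<sigma>) \<le> \<delta>" by blast
  have "prob (Bad \<sigma>) = 1 - prob (costs_at_least n d A (F \<sigma>) \<epsilon> T)"
    unfolding Bad_def by (rule prob_compl[OF good])
  then show ?thesis using bad centered[OF \<sigma>] unfolding F_def by (intro exI[of _ "center \<sigma>"]) simp
qed

end

section \<open>The lower bound\<close>

theorem theorem3:
  "\<exists>c\<^sub>0>0. \<exists>c>0. \<forall>\<delta>::real. 0 < \<delta> \<and> \<delta> < 1 \<longrightarrow>
    (\<exists>C>0. \<exists>p::nat.
      \<forall>(L::real) (\<Delta>::real) (\<epsilon>::real) (n::nat) (A :: nat \<Rightarrow> algorithm) (x0 :: nat \<Rightarrow> point).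
        L > 0 \<longrightarrow> \<Delta> > 0 \<longrightarrow> \<epsilon> > 0 \<longrightarrow>
        2 \<le> n \<longrightarrow> real n \<le> c\<^sub>0 * (\<Delta>\<^sup>2 * L\<^sup>2 / \<epsilon> ^ 4) \<longrightarrow>
        (\<forall>d. stochastic_first_order n d (A d)) \<longrightarrow>
        (\<forall>d. x0 d \<in> space (Rd d)) \<longrightarrow>
        (\<exists>(d::nat) (F :: nat \<Rightarrow> point \<Rightarrow> real).
           (let q = \<Delta>\<^sup>2 * L\<^sup>2 * (real n)\<^sup>2 / \<epsilon> ^ 4 in real d \<le> C * q * ln (q + 2) ^ p) \<and>
           initial_gap d (finite_sum n F) (x0 d) \<Delta> \<and>
           averaged_lipschitz_gradient n d F L \<and>
           measure seed (costs_at_least n d (A d) F \<epsilon> (c * (L * \<Delta> * sqrt (real n) / \<epsilon>\<^sup>2))) \<ge> 1 - \<delta>))"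
proof -
  \<comment> \<open>Any constant below \<open>4 / (9 * 768 * 163840)\<close> makes the gradient of unfinished instances exceed \<open>\<epsilon>\<close>.\<close>
  define \<kappa> :: real where "\<kappa> = 1 / 10 ^ 9"
  have \<kappa>: "\<kappa> > 0" by (simp add: \<kappa>_def)
  have main: "\<exists>d F. (let q = \<Delta>\<^sup>2 * L\<^sup>2 * (real n)\<^sup>2 / \<epsilon> ^ 4 in real d \<le> (4 * \<kappa>\<^sup>2 / sqrt \<delta>) * q * ln (q + 2) ^ 0) \<and>
           initial_gap d (finite_sum n F) (x0 d) \<Delta> \<and>
           averaged_lipschitz_gradient n d F L \<and>
           measure seed (costs_at_least n d (A d) F \<epsilon> (\<kappa> / 4 * (L * \<Delta> * sqrt (real n) / \<epsilon>\<^sup>2))) \<ge> 1 - \<delta>"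
    if \<delta>: "0 < \<delta>" "\<delta> < 1" and L: "L > 0" and \<Delta>: "\<Delta> > 0" and \<epsilon>: "\<epsilon> > 0" and n: "2 \<le> n"
      and n_le: "real n \<le> \<kappa>\<^sup>2 * (\<Delta>\<^sup>2 * L\<^sup>2 / \<epsilon> ^ 4)"
      and A: "\<And>d. stochastic_first_order n d (A d)"
    for \<delta> L \<Delta> \<epsilon> :: real and n :: nat and A :: "nat \<Rightarrow> algorithm" and x0 :: "nat \<Rightarrow> point"
  proof -
    define s where "s = sqrt (real n)"
    have s: "s > 0" "s * s = real n" using n by (simp_all add: s_def)
    define r where "r = \<kappa> * (L * \<Delta> / (s * \<epsilon>\<^sup>2))"
    have r0: "r > 0" using \<kappa> L \<Delta> s \<epsilon> by (simp add: r_def)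
    \<comment> \<open>The upper bound on \<open>n\<close> says exactly that a chain has room for at least one link.\<close>
    have "s\<^sup>2 \<le> (\<kappa> * (\<Delta> * L / \<epsilon>\<^sup>2))\<^sup>2"
      using n_le s by (simp add: power2_eq_square power4_eq_xxxx mult_ac)
    then have "s \<le> \<kappa> * (\<Delta> * L / \<epsilon>\<^sup>2)"
      by (rule power2_le_imp_le) (use \<kappa> L \<Delta> \<epsilon> in simp)
    then have r1: "1 \<le> r" using s \<epsilon> by (simp add: r_def field_simps)
    define K where "K = nat \<lfloor>r\<rfloor>"
    have "1 \<le> \<lfloor>r\<rfloor>" using r1 by simp
    moreover from this have "real K = of_int \<lfloor>r\<rfloor>" by (simp add: K_def)
    ultimately have K: "real K \<le> r" "r / 2 \<le> real K" "0 < K"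
      using floor_correct[of r] by linarith+
    define N where "N = real n * real K"
    define m where "m = nat \<lceil>N / sqrt \<delta>\<rceil>"
    have N1: "1 \<le> N" unfolding N_def using mult_mono[of 1 "real n" 1 "real K"] n K(3) by simp
    have sq\<delta>: "0 < sqrt \<delta>" "sqrt \<delta> \<le> 1" using \<delta> by simp_all
    then have Nd: "1 \<le> N / sqrt \<delta>" using order_trans[OF sq\<delta>(2) N1] by simp
    then have m: "N / sqrt \<delta> \<le> real m" "real m \<le> 2 * (N / sqrt \<delta>)" "0 < m" unfolding m_def by linarith+
    define d where "d = n * K * (2 * m)"
    define W where "W = {..<m} \<times> {..<m}"
    obtain pos and word :: "nat \<times> nat \<Rightarrow> nat \<Rightarrow> real" where "chains d n K pos"
      and norm: "\<And>b w. b \<in> {1..n} \<times> {..<K} \<Longrightarrow> w \<in> W \<Longrightarrow> (\<Sum>j\<in>{j. j < d \<and> pos j = b}. (word w j)\<^sup>2) = 2"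
      and apart: "\<And>b w w'. b \<in> {1..n} \<times> {..<K} \<Longrightarrow> w \<in> W \<Longrightarrow> w' \<in> W \<Longrightarrow> w \<noteq> w' \<Longrightarrow>
        2 \<le> (\<Sum>j\<in>{j. j < d \<and> pos j = b}. (word w j - word w' j)\<^sup>2)"
      by (rule exists_code[OF _ K(3) m(3), of n, folded d_def W_def]) (use n in auto)
    then interpret chains d n K pos by simp
    define p0 where "p0 = word (0, 0)"
    have p0: "centered p0" using norm[of _ "(0, 0)"] m by (simp add: centered_def block_def p0_def W_def)
    define \<alpha> where "\<alpha> = \<Delta> / gap p0"
    \<comment> \<open>Scaling values by \<open>\<alpha>\<close> makes the gap \<open>\<Delta>\<close>; this \<open>\<beta>\<close> makes each chain \<open>sqrt n * L\<close>-smooth.\<close>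
    define \<beta> where "\<beta> = sqrt (384 * \<alpha> / (s * L))"
    have \<alpha>: "\<alpha> > 0" using gap_pos[OF p0] \<Delta> by (simp add: \<alpha>_def)
    have \<beta>: "\<beta> > 0" "\<beta>\<^sup>2 = 384 * \<alpha> / (sqrt n * L)" using \<alpha> s L by (simp_all add: \<beta>_def s_def[symmetric])
    have "\<exists>p. centered p \<and> measure seed (costs_at_least n d (A d) (component p (x0 d) \<alpha> \<beta>) \<epsilon>
        (\<kappa> / 4 * (L * \<Delta> * sqrt (real n) / \<epsilon>\<^sup>2))) \<ge> 1 - \<delta>"
    proof (rule resisting_instance[OF A \<alpha> L \<beta>, where W = W and word = word])
      show "finite W" "W \<noteq> {}" using m by (auto simp: W_def)
      have "N\<^sup>2 / \<delta> = (N / sqrt \<delta>)\<^sup>2" using \<delta> by (simp add: power_divide)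
      also have "\<dots> \<le> (real m)\<^sup>2" using m Nd by (intro power_mono) auto
      also have "\<dots> = real (card W)" by (simp add: W_def power2_eq_square)
      finally show "(real n * real K)\<^sup>2 \<le> \<delta> * real (card W)" using \<delta> by (simp add: N_def field_simps)
      have "\<kappa> / 4 * (L * \<Delta> * sqrt (real n) / \<epsilon>\<^sup>2) = (s * s) * (r / 4)"
        unfolding r_def s_def[symmetric] using s(1) by (simp add: mult_ac)
      also have "\<dots> = real n * (r / 4)" by (simp only: s(2))
      finally have T: "\<kappa> / 4 * (L * \<Delta> * sqrt (real n) / \<epsilon>\<^sup>2) = real n * (r / 4)" .
      have "real n * (r / 2) \<le> real n * real K" using K(2) by (intro mult_left_mono) auto
      then show "2 * (\<kappa> / 4 * (L * \<Delta> * sqrt (real n) / \<epsilon>\<^sup>2)) \<le> real n * real K" unfolding T by (simp add: mult.commute)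
      have "gap p0 \<le> 9/4 * r" using gap_le[of p0] K(1) by linarith
      then have "\<Delta> / (9/4 * r) \<le> \<alpha>"
        unfolding \<alpha>_def using \<Delta> gap_pos[OF p0] by (intro divide_left_mono) (auto intro: mult_pos_pos r0)
      then have below: "\<Delta> / (9/4 * r) * (L / (s * (768 * 163840))) \<le> \<alpha> * (L / (s * (768 * 163840)))"
        using L s by (intro mult_right_mono) auto
      have "\<epsilon>\<^sup>2 * 1 \<le> \<epsilon>\<^sup>2 * (4 * 10 ^ 9 / (9 * 768 * 163840))"
        by (intro mult_left_mono) auto
      also have "\<dots> = \<Delta> / (9/4 * r) * (L / (s * (768 * 163840)))"
        unfolding r_def \<kappa>_def using L \<Delta> s \<epsilon> by (simp add: field_simps)
      also note below
      also have "\<alpha> * (L / (s * (768 * 163840))) = \<alpha> * L / (sqrt n * (768 * 163840))"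
        by (simp add: s_def)
      finally show "\<epsilon>\<^sup>2 \<le> \<alpha> * L / (sqrt n * (768 * 163840))" by (simp only: mult_1_right)
    qed (use norm apart \<epsilon> in \<open>auto simp: block_def\<close>)
    then obtain p where p: "centered p"
      and cost: "measure seed (costs_at_least n d (A d) (component p (x0 d) \<alpha> \<beta>) \<epsilon>
        (\<kappa> / 4 * (L * \<Delta> * sqrt (real n) / \<epsilon>\<^sup>2))) \<ge> 1 - \<delta>" by blast
    have "\<alpha> = \<Delta> / gap p" unfolding \<alpha>_def using gap_unique[OF p0 p] by simp
    then have gap: "initial_gap d (finite_sum n (component p (x0 d) \<alpha> \<beta>)) (x0 d) \<Delta>"
      using initial_gap_component[OF p \<Delta> \<beta>(1)] by simp
    have lip: "averaged_lipschitz_gradient n d (component p (x0 d) \<alpha> \<beta>) L"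
      by (rule averaged_lipschitz_component[OF \<alpha> L \<beta>])
    have "real d = 2 * N * real m" by (simp add: d_def N_def)
    also have "\<dots> \<le> 2 * N * (2 * (N / sqrt \<delta>))" using m N1 by (intro mult_left_mono) auto
    also have "\<dots> = 4 * N\<^sup>2 / sqrt \<delta>" by (simp add: power2_eq_square)
    finally have "real d \<le> 4 * N\<^sup>2 / sqrt \<delta>" .
    have "N\<^sup>2 \<le> \<kappa>\<^sup>2 * (\<Delta>\<^sup>2 * L\<^sup>2 * (real n)\<^sup>2 / \<epsilon> ^ 4)"
    proof -
      have "N\<^sup>2 \<le> (real n * r)\<^sup>2"
        unfolding N_def using K(1) by (intro power_mono mult_left_mono) auto
      also have "real n * r = \<kappa> * (\<Delta> * L * s / \<epsilon>\<^sup>2)"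
        unfolding r_def s(2)[symmetric] using s(1) by (simp add: mult_ac)
      also have "(\<kappa> * (\<Delta> * L * s / \<epsilon>\<^sup>2))\<^sup>2 = \<kappa>\<^sup>2 * (\<Delta>\<^sup>2 * L\<^sup>2 * real n / \<epsilon> ^ 4)"
        unfolding s(2)[symmetric] by (simp add: power2_eq_square power4_eq_xxxx mult_ac)
      also have "\<dots> \<le> \<kappa>\<^sup>2 * (\<Delta>\<^sup>2 * L\<^sup>2 * (real n)\<^sup>2 / \<epsilon> ^ 4)"
        using n \<epsilon> by (intro divide_right_mono mult_left_mono) (auto simp: power2_eq_square)
      finally show ?thesis .
    qed
    then have "4 * N\<^sup>2 / sqrt \<delta> \<le> 4 * (\<kappa>\<^sup>2 * (\<Delta>\<^sup>2 * L\<^sup>2 * (real n)\<^sup>2 / \<epsilon> ^ 4)) / sqrt \<delta>"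
      using sq\<delta> by (intro divide_right_mono mult_left_mono) auto
    with \<open>real d \<le> 4 * N\<^sup>2 / sqrt \<delta>\<close>
    have "real d \<le> 4 * (\<kappa>\<^sup>2 * (\<Delta>\<^sup>2 * L\<^sup>2 * (real n)\<^sup>2 / \<epsilon> ^ 4)) / sqrt \<delta>" by (rule order_trans)
    then have dim: "real d \<le> 4 * \<kappa>\<^sup>2 / sqrt \<delta> * (\<Delta>\<^sup>2 * L\<^sup>2 * (real n)\<^sup>2 / \<epsilon> ^ 4)"
      by (simp add: mult_ac)
    show ?thesis
      by (intro exI[of _ d] exI[of _ "component p (x0 d) \<alpha> \<beta>"] conjI gap lip cost) (use dim in \<open>simp only: Let_def power_0 mult_1_right\<close>)
  qed
  show ?thesis
  proof (rule exI[of _ "\<kappa>\<^sup>2"], rule conjI, (use \<kappa> in simp),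
      rule exI[of _ "\<kappa> / 4"], rule conjI, (use \<kappa> in simp), intro allI impI, elim conjE)
    fix \<delta> :: real assume \<delta>: "0 < \<delta>" "\<delta> < 1"
    then have C: "4 * \<kappa>\<^sup>2 / sqrt \<delta> > 0" using \<kappa> by simp
    show "\<exists>C>0. \<exists>p::nat.
      \<forall>(L::real) (\<Delta>::real) (\<epsilon>::real) (n::nat) (A :: nat \<Rightarrow> algorithm) (x0 :: nat \<Rightarrow> point).
        L > 0 \<longrightarrow> \<Delta> > 0 \<longrightarrow> \<epsilon> > 0 \<longrightarrow>
        2 \<le> n \<longrightarrow> real n \<le> \<kappa>\<^sup>2 * (\<Delta>\<^sup>2 * L\<^sup>2 / \<epsilon> ^ 4) \<longrightarrow>
        (\<forall>d. stochastic_first_order n d (A d)) \<longrightarrow>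
        (\<forall>d. x0 d \<in> space (Rd d)) \<longrightarrow>
        (\<exists>(d::nat) (F :: nat \<Rightarrow> point \<Rightarrow> real).
           (let q = \<Delta>\<^sup>2 * L\<^sup>2 * (real n)\<^sup>2 / \<epsilon> ^ 4 in real d \<le> C * q * ln (q + 2) ^ p) \<and>
           initial_gap d (finite_sum n F) (x0 d) \<Delta> \<and>
           averaged_lipschitz_gradient n d F L \<and>
           measure seed (costs_at_least n d (A d) F \<epsilon> (\<kappa> / 4 * (L * \<Delta> * sqrt (real n) / \<epsilon>\<^sup>2))) \<ge> 1 - \<delta>)"
    proof (rule exI[of _ "4 * \<kappa>\<^sup>2 / sqrt \<delta>"], rule conjI, rule C, rule exI[of _ 0], intro allI impI)
      fix L \<Delta> \<epsilon> :: real and n :: nat and A :: "nat \<Rightarrow> algorithm" and x0 :: "nat \<Rightarrow> point"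
      assume "L > 0" "\<Delta> > 0" "\<epsilon> > 0" "2 \<le> n" "real n \<le> \<kappa>\<^sup>2 * (\<Delta>\<^sup>2 * L\<^sup>2 / \<epsilon> ^ 4)"
        and A: "\<forall>d. stochastic_first_order n d (A d)"
      then show "\<exists>d F. (let q = \<Delta>\<^sup>2 * L\<^sup>2 * (real n)\<^sup>2 / \<epsilon> ^ 4
             in real d \<le> (4 * \<kappa>\<^sup>2 / sqrt \<delta>) * q * ln (q + 2) ^ 0) \<and>
           initial_gap d (finite_sum n F) (x0 d) \<Delta> \<and>
           averaged_lipschitz_gradient n d F L \<and>
           measure seed (costs_at_least n d (A d) F \<epsilon> (\<kappa> / 4 * (L * \<Delta> * sqrt (real n) / \<epsilon>\<^sup>2))) \<ge> 1 - \<delta>"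
        by (intro main[OF \<delta>]) blast+
    qed
  qed
qed

end
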